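(* Let $n_1,n_2\ge1$, $1<p<\infty$, and let $w$ be a weight on $\mathbb{R}^{n_1}\times\mathbb{R}^{n_2}$ with $w\in A_{p,\mathcal{R}}$. There is a constant $C>0$ independent of $w$, $R$, $f$ such that for every $R=I_1\times I_2\in\mathcal{R}$ and every $f\in C^2(R)$, $$\|f-\pi_R(f)\|_{L^p(R,w)}\le C\,[w]_{A_{p,\mathcal{R}}}^{\min\{4,\frac{2}{p-1}\}}\,\ell(I_1)\,\ell(I_2)\,\|\nabla_x\nabla_y f\|_{L^p(R,w)}.$$
   Context: $\mathcal{R}$ is the family of rectangles $R=I_1\times I_2$ with $I_1\subset\mathbb{R}^{n_1}$, $I_2\subset\mathbb{R}^{n_2}$ cubes with sides parallel to the axes; $\ell(I)$ is the side length. Points are $(x,y)$, $x\in\mathbb{R}^{n_1}$, $y\in\mathbb{R}^{n_2}$. A weight is a nonnegative locally integrable function; $[w]_{A_{p,\mathcal{R}}}:=\sup_{R\in\mathcal{R}}\big(\frac1{|R|}\int_R w\big)\big(\frac1{|R|}\int_R w^{-\frac1{p-1}}\big)^{p-1}$ and $w\in A_{p,\mathcal{R}}$ means this is finite. For $R=I_1\times I_2$: $\pi_R(f)(x,y):=\frac1{|I_1|}\int_{I_1}f(s,y)\,ds+\frac1{|I_2|}\int_{I_2}f(x,t)\,dt-\frac1{|R|}\int_R f$. $|\nabla_x\nabla_y f|=\big(\sum_{i,j}|\frac{\partial^2 f}{\partial x_i\partial y_j}|^2\big)^{1/2}$ and $\|g\|_{L^p(R,w)}=(\int_R|g|^pw)^{1/p}$.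 *)

theory Defs
  imports "HOL-Analysis.Analysis"
begin

type_synonym ('n,'m) pt = "(real^'n) \<times> (real^'m)"

definition cube :: "real^('n::finite) \<Rightarrow> real \<Rightarrow> (real^'n) set" where
  "cube a h = cbox a (a + h *\<^sub>R One)"

definition rect :: "real^'n \<Rightarrow> real \<Rightarrow> real^'m \<Rightarrow> real \<Rightarrow> ('n::finite,'m::finite) pt set" where
  "rect a h b k = cube a h \<times> cube b k"

definition rects :: "('n::finite,'m::finite) pt set set" where
  "rects = {rect a h b k | a h b k. 0 < h \<and> 0 < k}"

definition weight :: "(('n::finite,'m::finite) pt \<Rightarrow> real) \<Rightarrow> bool" where
  "weight w \<longleftrightarrow> (\<forall>z. 0 \<le> w z) \<and>
     (\<forall>K. compact K \<longrightarrow> set_integrable lebesgue K w)"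

text \<open>w^(-1/(p-1)), with the convention 0^(negative) = infinity.\<close>
definition dual_wt :: "real \<Rightarrow> (('n::finite,'m::finite) pt \<Rightarrow> real) \<Rightarrow> ('n,'m) pt \<Rightarrow> ennreal" where
  "dual_wt p w z = (if w z = 0 then \<infinity> else ennreal (w z powr (-1 / (p - 1))))"

definition avg :: "('n::finite,'m::finite) pt set \<Rightarrow> (('n,'m) pt \<Rightarrow> ennreal) \<Rightarrow> ennreal" where
  "avg R g = (\<integral>\<^sup>+ z\<in>R. g z \<partial>lebesgue) / ennreal (measure lebesgue R)"

definition Ap_quantity :: "real \<Rightarrow> (('n::finite,'m::finite) pt \<Rightarrow> real) \<Rightarrow> ('n,'m) pt set \<Rightarrow> real" where
  "Ap_quantity p w R =
     enn2real (avg R (\<lambda>z. ennreal (w z))) * enn2real (avg R (dual_wt p w)) powr (p - 1)"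

definition in_Ap :: "real \<Rightarrow> (('n::finite,'m::finite) pt \<Rightarrow> real) \<Rightarrow> bool" where
  "in_Ap p w \<longleftrightarrow>
     (\<forall>R\<in>rects. avg R (\<lambda>z. ennreal (w z)) < \<infinity> \<and> avg R (dual_wt p w) < \<infinity>) \<and>
     bdd_above (Ap_quantity p w ` rects)"

definition Ap_const :: "real \<Rightarrow> (('n::finite,'m::finite) pt \<Rightarrow> real) \<Rightarrow> real" where
  "Ap_const p w = (SUP R\<in>rects. Ap_quantity p w R)"

definition dirderiv :: "'a::real_normed_vector \<Rightarrow> ('a \<Rightarrow> real) \<Rightarrow> 'a \<Rightarrow> real" where
  "dirderiv v g z = deriv (\<lambda>t. g (z + t *\<^sub>R v)) 0"

definition C2_on :: "'a::euclidean_space set \<Rightarrow> ('a \<Rightarrow> real) \<Rightarrow> bool" where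
  "C2_on U g \<longleftrightarrow> open U \<and> g differentiable_on U \<and>
     (\<forall>u\<in>Basis. dirderiv u g differentiable_on U) \<and>
     (\<forall>u\<in>Basis. \<forall>v\<in>Basis. continuous_on U (dirderiv v (dirderiv u g)))"

definition mixed :: "'n \<Rightarrow> 'm \<Rightarrow> (('n::finite,'m::finite) pt \<Rightarrow> real) \<Rightarrow> ('n,'m) pt \<Rightarrow> real" where
  "mixed i j f = dirderiv (0, axis j 1) (dirderiv (axis i 1, 0) f)"

definition mixed_grad_norm :: "(('n::finite,'m::finite) pt \<Rightarrow> real) \<Rightarrow> ('n::finite,'m::finite) pt \<Rightarrow> real" where
  "mixed_grad_norm f z = sqrt (\<Sum>i\<in>UNIV. \<Sum>j\<in>UNIV. (mixed i j f z)\<^sup>2)"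

definition Lpw :: "real \<Rightarrow> ('n::finite,'m::finite) pt set \<Rightarrow> (('n,'m) pt \<Rightarrow> real) \<Rightarrow> (('n,'m) pt \<Rightarrow> real) \<Rightarrow> real" where
  "Lpw p R w g = (LINT z:R|lebesgue. \<bar>g z\<bar> powr p * w z) powr (1 / p)"

definition piR :: "(real^'n) set \<Rightarrow> (real^'m) set \<Rightarrow> (('n::finite,'m::finite) pt \<Rightarrow> real) \<Rightarrow> ('n,'m) pt \<Rightarrow> real" where
  "piR I1 I2 f z =
     (LINT s:I1|lebesgue. f (s, snd z)) / measure lebesgue I1
   + (LINT t:I2|lebesgue. f (fst z, t)) / measure lebesgue I2
   - (LINT u:(I1 \<times> I2)|lebesgue. f u) / measure lebesgue (I1 \<times> I2)"

end

theory Submission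
  imports Defs
begin

text \<open>
  Write \<open>z = (x, y)\<close>, \<open>R\<close> for the rectangle and \<open>G\<close> for the mixed gradient norm of \<open>f\<close>. The
  difference \<open>f - \<pi>\<^sub>R f\<close> at \<open>z\<close> is the average over \<open>(x', y')\<close> in \<open>R\<close> of the mixed difference
  \<open>f (x, y) - f (x', y) - f (x, y') + f (x', y')\<close>, which the fundamental theorem of calculus bounds
  by \<open>c h k\<close> times the integral of \<open>G (x + s (x' - x), y + t (y' - y))\<close> over \<open>s, t\<close> in \<open>(0, 1]\<close>.
  For fixed \<open>s, t\<close> the average over \<open>(x', y')\<close> is, after a dilation, at most a multiple of the average
  of \<open>G\<close> over a rectangle of sides \<open>2 s h, 2 t k\<close> centred at \<open>z\<close>. By Holder, Tonelli and the
  \<open>A\<^sub>p\<close> condition on a doubled rectangle, these averaging operators are bounded on \<open>L\<^sup>p(w)\<close> with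
  norm at most \<open>C [w]\<^bsup>1/p\<^esup>\<close>, uniformly in \<open>s, t\<close>, and Jensen over \<open>(s, t)\<close> sums them up. No
  maximal function is needed, and as \<open>[w] \<ge> 1\<close> the exponent \<open>1/p\<close> is better than the one claimed.
\<close>

subsection \<open>Holder and Jensen from Young\<close>

text \<open>Young's inequality for the product of \<open>g * u powr (1/p)\<close> and
  \<open>a powr (p - 1) * u powr (-1/p)\<close>, in which the powers of \<open>u\<close> cancel;
  multiplying by \<open>p\<close> gives the form below, since \<open>p / q = p - 1\<close>. The free
  parameter \<open>a\<close> is kept so that it can be optimised after integration.\<close>

lemma Young_dual_weight:
  fixes p a g u :: real
  assumes p: "1 < p" and a: "0 < a" and g: "0 \<le> g" and u: "0 < u"
  shows "p * a powr (p - 1) * g \<le> g powr p * u + (p - 1) * a powr p * u powr (-1 / (p - 1))"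
proof -
  define q where "q = p / (p - 1)"
  have q: "1 < q" "1 / p + 1 / q = 1" using p by (auto simp: q_def field_simps)
  have "(g * u powr (1/p)) * (a powr (p - 1) * u powr (-1/p))
      \<le> (g * u powr (1/p)) powr p / p + (a powr (p - 1) * u powr (-1/p)) powr q / q"
    by (rule Youngs_inequality) (use p q g in auto)
  moreover have "(g * u powr (1/p)) * (a powr (p - 1) * u powr (-1/p)) = g * a powr (p - 1)"
    using u by (simp add: powr_minus field_simps)
  moreover have "(g * u powr (1/p)) powr p = g powr p * u"
    using p g u by (simp add: powr_mult powr_powr)
  moreover have "(a powr (p - 1) * u powr (-1/p)) powr q = a powr p * u powr (-1 / (p - 1))"
    using p u a by (simp add: powr_mult powr_powr q_def)
  ultimately have "g * a powr (p - 1) \<le> g powr p * u / p + a powr p * u powr (-1 / (p - 1)) / q"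
    by (simp only:)
  then have "p * (g * a powr (p - 1)) \<le> p * (g powr p * u / p + a powr p * u powr (-1 / (p - 1)) / q)"
    using p by (intro mult_left_mono) auto
  also have "\<dots> = g powr p * u + (p / q) * a powr p * u powr (-1 / (p - 1))"
    using p by (simp add: field_simps)
  also have "p / q = p - 1" using p by (simp add: q_def)
  finally show ?thesis by (simp add: mult_ac)
qed

text \<open>The pointwise hypothesis is Young's inequality; optimising over \<open>a\<close> gives Holder.\<close>
lemma nn_integral_Holder_of_Young:
  fixes p I S :: real and G Q d :: "'a \<Rightarrow> ennreal"
  assumes p: "1 < p"
    and [measurable]: "G \<in> borel_measurable M" "Q \<in> borel_measurable M" "d \<in> borel_measurable M"
    and young: "\<And>x a. 0 < a \<Longrightarrow>
        ennreal (p * a powr (p - 1)) * G x \<le> Q x + ennreal ((p - 1) * a powr p) * d x"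
    and I: "integral\<^sup>N M G = ennreal I" "0 \<le> I"
    and S: "integral\<^sup>N M d = ennreal S" "0 < S"
  shows "ennreal (I powr p) \<le> ennreal (S powr (p - 1)) * integral\<^sup>N M Q"
\<comment> \<open>In the degenerate cases the left side is 0 or, because \<open>S\<close> is
  positive, the right side is \<open>top\<close>. Otherwise all quantities are finite reals.\<close>
proof (cases "I = 0 \<or> integral\<^sup>N M Q = top")
  case True
  then show ?thesis
    using S p by (auto simp: ennreal_mult_top)
next
  case False
  with I have "0 < I" by simp
  obtain q where q: "integral\<^sup>N M Q = ennreal q" "0 \<le> q" 
    using False by (cases "integral\<^sup>N M Q") auto
  \<comment> \<open>The optimal parameter: it makes \<open>a powr p * S\<close> equal to
    \<open>a powr (p - 1) * I\<close>, so the two terms merge with coefficient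
    \<open>p - (p - 1) = 1\<close>.\<close>
  define a where "a = I / S"
  have a: "0 < a" using \<open>0 < I\<close> S by (simp add: a_def)
  have "(\<integral>\<^sup>+x. ennreal (p * a powr (p - 1)) * G x \<partial>M) \<le> (\<integral>\<^sup>+x. Q x + ennreal ((p - 1) * a powr p) * d x \<partial>M)"
    by (intro nn_integral_mono young a)
  then have "ennreal (p * a powr (p - 1) * I) \<le> ennreal (q + (p - 1) * a powr p * S)"
    using p S I q by (simp add: nn_integral_add nn_integral_cmult ennreal_mult'' ennreal_plus)
  then have "p * a powr (p - 1) * I \<le> q + (p - 1) * a powr p * S"
    using p S q by (subst (asm) ennreal_le_iff) auto
  moreover have "a powr p * S = a powr (p - 1) * I"
  proof -
    have "a powr p = a powr (p - 1) * a" using a by (metis add.commute diff_add_cancel powr_mult_base less_imp_le mult.commute)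
    then show ?thesis using S by (simp add: a_def)
  qed
  ultimately have "p * (a powr (p - 1) * I) \<le> q + (p - 1) * (a powr (p - 1) * I)"
    by (simp add: mult.assoc)
  then have "a powr (p - 1) * I \<le> q" by (simp add: left_diff_distrib)
  moreover have "a powr (p - 1) * I * S powr (p - 1) = I powr p"
    using S \<open>0 < I\<close> by (simp add: a_def powr_divide powr_diff)
  ultimately have "I powr p \<le> S powr (p - 1) * q"
    using S by (metis mult.commute mult_right_mono powr_ge_zero)
  then show ?thesis using q by (simp add: ennreal_mult[symmetric] ennreal_leI)
qed

text \<open>Young's inequality holds pointwise for the weight and its dual, also where
  \<open>w\<close> vanishes, thanks to the convention that the dual weight is infinite
  there.\<close>

lemma nn_integral_Holder_dual_wt:
  fixes w G :: "('n::finite,'m::finite) pt \<Rightarrow> real"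
  assumes p: "1 < p" and [measurable]: "w \<in> borel_measurable borel" "G \<in> borel_measurable borel" "A \<in> sets borel"
    and w: "\<And>z. 0 \<le> w z" and G: "\<And>z. 0 \<le> G z"
    and I: "(\<integral>\<^sup>+z\<in>A. ennreal (G z) \<partial>lborel) = ennreal I" "0 \<le> I"
    and S: "(\<integral>\<^sup>+z\<in>A. dual_wt p w z \<partial>lborel) = ennreal S" "0 < S"
  shows "ennreal (I powr p) \<le> ennreal (S powr (p - 1)) * (\<integral>\<^sup>+z\<in>A. ennreal (G z powr p * w z) \<partial>lborel)"
proof (rule nn_integral_Holder_of_Young[OF p _ _ _ _ I S])
  show "(\<lambda>z. dual_wt p w z * indicator A z) \<in> borel_measurable lborel"
    unfolding dual_wt_def by measurable
  fix z and a :: real assume a: "0 < a"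
  show "ennreal (p * a powr (p - 1)) * (ennreal (G z) * indicator A z)
      \<le> ennreal (G z powr p * w z) * indicator A z + ennreal ((p - 1) * a powr p) * (dual_wt p w z * indicator A z)"
  proof (cases "w z = 0")
    \<comment> \<open>On \<open>A\<close> the dual weight makes the right side \<open>top\<close>;
      off \<open>A\<close> both sides are 0.\<close>
    case True
    then show ?thesis using p a by (auto simp: dual_wt_def ennreal_mult_top split: split_indicator)
  next
    case False
    then have "0 < w z" using w[of z] by simp
    from Young_dual_weight[OF p a G[of z] this] False p w[of z] G[of z] show ?thesis
      by (auto simp: dual_wt_def ennreal_mult[symmetric] ennreal_plus[symmetric] simp del: ennreal_plus
          intro!: ennreal_leI split: split_indicator)
  qed
qed measurable

text \<open>Holder against the constant function 1, whose integral over a probability space is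
  1.\<close>

lemma nn_integral_Jensen_powr:
  fixes G :: "'a \<Rightarrow> real"
  assumes p: "1 < p" and [measurable]: "G \<in> borel_measurable M" and G: "\<And>z. 0 \<le> G z"
    and I: "integral\<^sup>N M G = ennreal I" "0 \<le> I" and M: "emeasure M (space M) = 1"
  shows "ennreal (I powr p) \<le> (\<integral>\<^sup>+z. ennreal (G z powr p) \<partial>M)"
proof -
  have "ennreal (I powr p) \<le> ennreal (1 powr (p - 1)) * (\<integral>\<^sup>+z. ennreal (G z powr p) \<partial>M)"
  proof (rule nn_integral_Holder_of_Young[OF p, where d="\<lambda>_. 1" and G=G])
    fix z and a :: real assume a: "0 < a"
    from Young_dual_weight[OF p a G[of z], of 1] p G[of z] 
    show "ennreal (p * a powr (p - 1)) * ennreal (G z) \<le> ennreal (G z powr p) + ennreal ((p - 1) * a powr p) * 1"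
      by (auto simp: ennreal_mult[symmetric] ennreal_plus[symmetric] simp del: ennreal_plus intro!: ennreal_leI)
  qed (use I M in auto)
  then show ?thesis by simp
qed

subsection \<open>Averages over centred rectangles\<close>

lemma sum_Basis_nth: "(\<Sum>b\<in>Basis. (b :: real^'n) $ i) = 1"
  using inner_sum_left_Basis[of "axis i 1 :: real^'n" "\<lambda>_. 1"]
  by (simp add: cart_eq_inner_axis[of "sum _ _", symmetric] axis_in_Basis_iff)

lemma cube_eq: "cube a h = {x. \<forall>i. a $ i \<le> x $ i \<and> x $ i \<le> a $ i + h}"
  by (auto simp: cube_def mem_box_cart sum_Basis_nth)

lemma cube_abs_diff_le:
  assumes "x \<in> cube a h" "x' \<in> cube a h"
  shows "\<bar>x' $ i - x $ i\<bar> \<le> h"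
proof -
  have "a $ i \<le> x $ i" "x $ i \<le> a $ i + h" "a $ i \<le> x' $ i" "x' $ i \<le> a $ i + h"
    using assms by (auto simp: cube_eq)
  then show ?thesis by linarith
qed

lemma rect_borel [measurable]: "rect a h b k \<in> sets borel"
  by (auto simp: rect_def cube_def intro!: borel_closed closed_Times closed_cbox)

lemma emeasure_rect:
  fixes a :: "real^'n::finite" and b :: "real^'m::finite"
  assumes "0 < h" "0 < k"
  shows "emeasure lborel (rect a h b k) = ennreal (h ^ CARD('n) * k ^ CARD('m))"
    "measure lebesgue (rect a h b k) = h ^ CARD('n) * k ^ CARD('m)"
proof -
  have "emeasure lborel (rect a h b k) = emeasure lborel (cube a h) * emeasure lborel (cube b k)"
    by (simp add: rect_def cube_def lborel.emeasure_pair_measure_Times flip: lborel_prod)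
  also have "\<dots> = ennreal (h ^ CARD('n) * k ^ CARD('m))"
    using assms by (simp add: cube_def emeasure_lborel_cbox_eq ennreal_mult algebra_simps)
  finally show *: "emeasure lborel (rect a h b k) = ennreal (h ^ CARD('n) * k ^ CARD('m))" .
  then show "measure lebesgue (rect a h b k) = h ^ CARD('n) * k ^ CARD('m)"
    using assms by (simp add: measure_def main_part_sets)
qed

text \<open>Half sides \<open>r\<close> and \<open>q\<close> around the centre \<open>z\<close>. It
  is encoded as a \<open>rect\<close> so that volumes and the A_p bound apply to it directly, while
  centring makes membership symmetric in the two points.\<close>

definition nbhd :: "real \<Rightarrow> real \<Rightarrow> ('n::finite,'m::finite) pt \<Rightarrow> ('n,'m) pt set" where
  "nbhd r q z = rect (fst z - r *\<^sub>R One) (2 * r) (snd z - q *\<^sub>R One) (2 * q)"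

lemma mem_nbhd: "v \<in> nbhd r q z \<longleftrightarrow>
    (\<forall>i. \<bar>fst v $ i - fst z $ i\<bar> \<le> r) \<and> (\<forall>j. \<bar>snd v $ j - snd z $ j\<bar> \<le> q)"
  by (cases v) (auto simp: nbhd_def rect_def cube_eq sum_Basis_nth abs_le_iff algebra_simps all_conj_distrib)

lemma nbhd_sym: "v \<in> nbhd r q z \<longleftrightarrow> z \<in> nbhd r q v"
  by (simp add: mem_nbhd abs_minus_commute)

text \<open>The triangle inequality in each coordinate. It serves to replace a box that moves with
  \<open>z\<close> by one that depends on \<open>v\<close> alone.\<close>

lemma nbhd_subset: "v \<in> nbhd r q z \<Longrightarrow> nbhd r q z \<subseteq> nbhd (2 * r) (2 * q) v"
proof
  fix u assume "v \<in> nbhd r q z" "u \<in> nbhd r q z"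
  then have *: "\<bar>fst v $ i - fst z $ i\<bar> \<le> r" "\<bar>fst u $ i - fst z $ i\<bar> \<le> r"
    "\<bar>snd v $ j - snd z $ j\<bar> \<le> q" "\<bar>snd u $ j - snd z $ j\<bar> \<le> q" for i j
    by (auto simp: mem_nbhd)
  have "\<bar>fst u $ i - fst v $ i\<bar> \<le> 2 * r" "\<bar>snd u $ j - snd v $ j\<bar> \<le> 2 * q" for i j
    using *(1,2)[of i] *(3,4)[of j] by linarith+
  then show "u \<in> nbhd (2 * r) (2 * q) v" by (simp add: mem_nbhd)
qed

text \<open>The set of pairs (centre, member) is closed, hence Borel. This gives the joint
  measurability that Tonelli requires when the box moves with the point.\<close>

lemma borel_measurable_indicator_nbhd [measurable]:
  fixes f g :: "'a \<Rightarrow> ('n::finite,'m::finite) pt"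
  assumes [measurable]: "f \<in> measurable M borel" "g \<in> measurable M borel"
  shows "(\<lambda>x. indicator (nbhd r q (f x)) (g x) :: ennreal) \<in> borel_measurable M"
proof -
  let ?C = "{x :: ('n,'m) pt \<times> ('n,'m) pt. snd x \<in> nbhd r q (fst x)}"
  have "closed ?C"
    unfolding mem_nbhd
    by (intro closed_Collect_conj closed_Collect_all closed_Collect_le continuous_intros)
  then have [measurable]: "?C \<in> sets (borel \<Otimes>\<^sub>M borel)"
    unfolding borel_prod by (rule borel_closed)
  have "(\<lambda>x. indicator ?C (f x, g x) :: ennreal) \<in> borel_measurable M"
    by measurable
  then show ?thesis
    by (simp add: indicator_def)
qed

text \<open>The A_p condition for a Borel weight with integrals over \<open>lborel\<close>, where
  product measure results apply directly. \<open>Ap_bound\<close> is the usual inequality with the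
  averages multiplied out: one volume factor from \<open>w\<close> and \<open>p - 1\<close> from the
  dual weight give the power \<open>p\<close>.\<close>

locale Ap_weight =
  fixes p A :: real and w :: "('n::finite,'m::finite) pt \<Rightarrow> real"
  assumes p: "1 < p" and w_borel [measurable]: "w \<in> borel_measurable borel" and w_nonneg: "0 \<le> w z"
    and w_fin: "0 < h \<Longrightarrow> 0 < k \<Longrightarrow> (\<integral>\<^sup>+z\<in>rect a h b k. ennreal (w z) \<partial>lborel) < \<infinity>"
    and dual_fin: "0 < h \<Longrightarrow> 0 < k \<Longrightarrow> (\<integral>\<^sup>+z\<in>rect a h b k. dual_wt p w z \<partial>lborel) < \<infinity>"
    and Ap_bound: "0 < h \<Longrightarrow> 0 < k \<Longrightarrow>
        enn2real (\<integral>\<^sup>+z\<in>rect a h b k. ennreal (w z) \<partial>lborel) *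
        enn2real (\<integral>\<^sup>+z\<in>rect a h b k. dual_wt p w z \<partial>lborel) powr (p - 1)
          \<le> A * (h ^ CARD('n) * k ^ CARD('m)) powr p"
begin

lemma dual_borel [measurable]: "dual_wt p w \<in> borel_measurable borel"
  unfolding dual_wt_def[abs_def] by measurable

text \<open>The dual weight is positive or infinite at every point, so a zero integral would force
  the rectangle to be a null set. The lower bound is what allows the choice \<open>a = I / S\<close>
  in Holder.\<close>

lemma dual_pos:
  assumes "0 < h" "0 < k"
  shows "0 < enn2real (\<integral>\<^sup>+z\<in>rect a h b k. dual_wt p w z \<partial>lborel)"
proof -
  have "(\<integral>\<^sup>+z\<in>rect a h b k. dual_wt p w z \<partial>lborel) \<noteq> 0"
  proof
    assume "(\<integral>\<^sup>+z\<in>rect a h b k. dual_wt p w z \<partial>lborel) = 0"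
    then have "AE z in lborel. dual_wt p w z * indicator (rect a h b k) z = 0"
      by (subst (asm) nn_integral_0_iff_AE) auto
    then have "AE z in lborel. z \<notin> rect a h b k"
    proof eventually_elim
      case (elim z)
      then show ?case using w_nonneg[of z]
        by (auto simp: dual_wt_def split: if_splits split_indicator_asm)
    qed
    then have "emeasure lborel (rect a h b k) = 0"
      by (subst AE_iff_measurable[symmetric]) auto
    then show False using emeasure_rect(1)[OF assms, of a b] assms
      by (metis ennreal_eq_0_iff mult_pos_pos not_le zero_less_power)
  qed
  then show ?thesis using dual_fin[OF assms, of a b]
    by (simp add: enn2real_positive_iff less_top zero_less_iff_neq_zero)
qed

lemma Holder_rect:
  assumes hk: "0 < h" "0 < k" and [measurable]: "G \<in> borel_measurable borel"
    and G: "\<And>z. 0 \<le> G z" and GI: "(\<integral>\<^sup>+z\<in>rect a h b k. ennreal (G z) \<partial>lborel) = ennreal I" "0 \<le> I"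
  shows "ennreal (I powr p) \<le>
    ennreal (enn2real (\<integral>\<^sup>+z\<in>rect a h b k. dual_wt p w z \<partial>lborel) powr (p - 1)) *
      (\<integral>\<^sup>+z\<in>rect a h b k. ennreal (G z powr p * w z) \<partial>lborel)"
proof (rule nn_integral_Holder_dual_wt[OF p _ _ _ w_nonneg G GI])
  show "(\<integral>\<^sup>+z\<in>rect a h b k. dual_wt p w z \<partial>lborel)
      = ennreal (enn2real (\<integral>\<^sup>+z\<in>rect a h b k. dual_wt p w z \<partial>lborel))"
    using dual_fin[OF hk] by (simp add: less_top)
qed (use dual_pos[OF hk] in measurable)

text \<open>Holder for the constant 1 on the unit rectangle bounds 1 by the A_p product there. This
  later allows the exponent of \<open>A\<close> to be raised.\<close>

lemma A_ge_1: "1 \<le> A"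
proof -
  define W S where "W = (\<integral>\<^sup>+z\<in>rect 0 1 0 1. ennreal (w z) \<partial>lborel)"
    and "S = (\<integral>\<^sup>+z\<in>rect 0 1 0 1. dual_wt p w z \<partial>lborel)"
  have "ennreal (1 powr p) \<le> ennreal (enn2real S powr (p - 1)) * (\<integral>\<^sup>+z\<in>rect 0 1 0 1. ennreal (1 powr p * w z) \<partial>lborel)"
    unfolding S_def by (rule Holder_rect) (auto simp: emeasure_rect)
  also have "\<dots> = ennreal (enn2real S powr (p - 1)) * W" by (simp add: W_def)
  also have "W = ennreal (enn2real W)" using w_fin[of 1 1 0 0] by (simp add: W_def less_top)
  finally have "1 \<le> enn2real W * enn2real S powr (p - 1)"
    by (simp add: ennreal_mult[symmetric] mult.commute)
  also have "\<dots> \<le> A" using Ap_bound[of 1 1 0 0] by (simp add: W_def S_def)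
  finally show ?thesis .
qed

text \<open>Holder on the box around \<open>z\<close> produces the dual weight over that box, and
  Tonelli then integrates \<open>w\<close> over all \<open>z\<close> whose box contains
  \<open>v\<close>. Both integrals are enlarged to the doubled box around \<open>v\<close>, of sides
  \<open>4 * r\<close> and \<open>4 * q\<close>, where the A_p condition controls their
  product.\<close>

lemma averaging_bound:
  assumes rq: "0 < r" "0 < q" and [measurable]: "G \<in> borel_measurable borel"
    and G: "\<And>z. 0 \<le> G z" "\<And>z. G z \<le> B"
  shows "(\<integral>\<^sup>+z. ennreal (w z * enn2real (\<integral>\<^sup>+v\<in>nbhd r q z. ennreal (G v) \<partial>lborel) powr p) \<partial>lborel)
    \<le> ennreal (A * ((4 * r) ^ CARD('n) * (4 * q) ^ CARD('m)) powr p) *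
        (\<integral>\<^sup>+z. ennreal (G z powr p * w z) \<partial>lborel)"
proof -
  define I where "I z = enn2real (\<integral>\<^sup>+v\<in>nbhd r q z. ennreal (G v) \<partial>lborel)" for z
  define S2 where "S2 z = enn2real (\<integral>\<^sup>+v\<in>nbhd (2*r) (2*q) z. dual_wt p w v \<partial>lborel)" for z
  define W2 where "W2 z = enn2real (\<integral>\<^sup>+v\<in>nbhd (2*r) (2*q) z. ennreal (w v) \<partial>lborel)" for z
  have [measurable]: "S2 \<in> borel_measurable borel"
    unfolding S2_def by measurable
  have I_eq: "(\<integral>\<^sup>+v\<in>nbhd r q z. ennreal (G v) \<partial>lborel) = ennreal (I z)" for z
  proof -
    \<comment> \<open>Boundedness of \<open>G\<close> makes the integral finite, so
      \<open>enn2real\<close> loses nothing.\<close>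
    have "(\<integral>\<^sup>+v\<in>nbhd r q z. ennreal (G v) \<partial>lborel) \<le> (\<integral>\<^sup>+v\<in>nbhd r q z. ennreal B \<partial>lborel)"
      using G by (intro nn_integral_mono mult_right_mono ennreal_leI) auto
    also have "\<dots> < top"
      using rq by (simp add: nbhd_def nn_integral_cmult emeasure_rect ennreal_mult_less_top)
    finally show ?thesis by (simp add: I_def)
  qed
  have dual_N2: "(\<integral>\<^sup>+v\<in>nbhd (2*r) (2*q) z. dual_wt p w v \<partial>lborel) < top" for z
    using rq dual_fin by (simp add: nbhd_def)
  have w_N2: "(\<integral>\<^sup>+v\<in>nbhd (2*r) (2*q) z. ennreal (w v) \<partial>lborel) = ennreal (W2 z)" for z
    using rq w_fin[of "2*(2*r)" "2*(2*q)"] by (simp add: nbhd_def W2_def less_top)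
  have Ap_N2: "W2 z * S2 z powr (p - 1) \<le> A * ((4 * r) ^ CARD('n) * (4 * q) ^ CARD('m)) powr p" for z
    unfolding W2_def S2_def nbhd_def by (rule order_trans[OF Ap_bound]) (use rq in auto)
  have Holder: "ennreal (I z powr p) \<le>
      (\<integral>\<^sup>+v. ennreal (G v powr p * w v) * (indicator (nbhd r q z) v * ennreal (S2 v powr (p - 1))) \<partial>lborel)" for z
  proof -
    let ?S = "enn2real (\<integral>\<^sup>+v\<in>nbhd r q z. dual_wt p w v \<partial>lborel)"
    have "ennreal (I z powr p) \<le> ennreal (?S powr (p - 1)) * (\<integral>\<^sup>+v\<in>nbhd r q z. ennreal (G v powr p * w v) \<partial>lborel)"
      using rq G I_eq[of z] unfolding nbhd_def by (intro Holder_rect) (auto simp: I_def)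
    also have "\<dots> = (\<integral>\<^sup>+v. ennreal (?S powr (p - 1)) * (ennreal (G v powr p * w v) * indicator (nbhd r q z) v) \<partial>lborel)"
      by (rule nn_integral_cmult[symmetric]) measurable
    \<comment> \<open>The dual integral over the box around \<open>z\<close> is replaced by
      \<open>S2 v\<close>, which is constant in the \<open>z\<close> integral once the order is
      exchanged.\<close>
    also have "\<dots> \<le> (\<integral>\<^sup>+v. ennreal (G v powr p * w v) * (indicator (nbhd r q z) v * ennreal (S2 v powr (p - 1))) \<partial>lborel)"
    proof (rule nn_integral_mono)
      fix v
      show "ennreal (?S powr (p - 1)) * (ennreal (G v powr p * w v) * indicator (nbhd r q z) v)
          \<le> ennreal (G v powr p * w v) * (indicator (nbhd r q z) v * ennreal (S2 v powr (p - 1)))"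
      proof (cases "v \<in> nbhd r q z")
        case True
        from nbhd_subset[OF this]
        have "(\<integral>\<^sup>+v\<in>nbhd r q z. dual_wt p w v \<partial>lborel) \<le> (\<integral>\<^sup>+v\<in>nbhd (2*r) (2*q) v. dual_wt p w v \<partial>lborel)"
          by (intro nn_integral_mono mult_left_mono) (auto split: split_indicator)
        then have "?S \<le> S2 v"
          unfolding S2_def by (rule enn2real_mono) (rule dual_N2)
        then have "ennreal (?S powr (p - 1)) \<le> ennreal (S2 v powr (p - 1))"
          using p by (intro ennreal_leI powr_mono2) auto
        then show ?thesis using True by (simp add: mult.commute[of _ "ennreal (G v powr p * w v)"] mult_left_mono)
      qed simp
    qed
    finally show ?thesis .
  qed
  have "(\<integral>\<^sup>+z. ennreal (w z * I z powr p) \<partial>lborel) \<le>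
      (\<integral>\<^sup>+z. \<integral>\<^sup>+v. ennreal (w z) * (ennreal (G v powr p * w v) * (indicator (nbhd r q z) v * ennreal (S2 v powr (p - 1)))) \<partial>lborel \<partial>lborel)"
    using Holder w_nonneg by (auto simp: nn_integral_cmult ennreal_mult intro!: nn_integral_mono mult_left_mono)
  also have "\<dots> = (\<integral>\<^sup>+v. \<integral>\<^sup>+z. ennreal (w z) * (ennreal (G v powr p * w v) * (indicator (nbhd r q z) v * ennreal (S2 v powr (p - 1)))) \<partial>lborel \<partial>lborel)"
    by (rule lborel_pair.Fubini'[symmetric]) measurable
  also have "\<dots> \<le> (\<integral>\<^sup>+v. ennreal (A * ((4 * r) ^ CARD('n) * (4 * q) ^ CARD('m)) powr p) * ennreal (G v powr p * w v) \<partial>lborel)"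
  proof (rule nn_integral_mono)
    fix v :: "('n,'m) pt"
    let ?c = "ennreal (G v powr p * w v) * ennreal (S2 v powr (p - 1))"
    have "(\<integral>\<^sup>+z. ennreal (w z) * (ennreal (G v powr p * w v) * (indicator (nbhd r q z) v * ennreal (S2 v powr (p - 1)))) \<partial>lborel)
        \<le> (\<integral>\<^sup>+z. ?c * (ennreal (w z) * indicator (nbhd (2*r) (2*q) v) z) \<partial>lborel)"
    proof (rule nn_integral_mono)
      fix z
      \<comment> \<open>By symmetry \<open>z\<close> lies in the box around \<open>v\<close>;
        doubling that box makes \<open>W2\<close> and \<open>S2\<close> refer to the same
        rectangle.\<close>
      have "indicator (nbhd r q z) v \<le> (indicator (nbhd (2*r) (2*q) v) z :: ennreal)"
        using nbhd_subset[of v r q v] nbhd_sym[of v r q z] rq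
        by (auto simp: mem_nbhd[of v r q v] split: split_indicator)
      then have "?c * ennreal (w z) * indicator (nbhd r q z) v \<le> ?c * ennreal (w z) * indicator (nbhd (2*r) (2*q) v) z"
        by (intro mult_left_mono) auto
      then show "ennreal (w z) * (ennreal (G v powr p * w v) * (indicator (nbhd r q z) v * ennreal (S2 v powr (p - 1))))
        \<le> ?c * (ennreal (w z) * indicator (nbhd (2*r) (2*q) v) z)"
        by (simp add: mult_ac)
    qed
    also have "\<dots> = ?c * ennreal (W2 v)"
      by (subst nn_integral_cmult) (auto simp: w_N2)
    also have "\<dots> = ennreal (W2 v * S2 v powr (p - 1)) * ennreal (G v powr p * w v)"
      by (simp add: ennreal_mult W2_def mult_ac)
    also have "\<dots> \<le> ennreal (A * ((4 * r) ^ CARD('n) * (4 * q) ^ CARD('m)) powr p) * ennreal (G v powr p * w v)"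
      by (intro mult_right_mono ennreal_leI Ap_N2) auto
    finally show "(\<integral>\<^sup>+z. ennreal (w z) * (ennreal (G v powr p * w v) * (indicator (nbhd r q z) v * ennreal (S2 v powr (p - 1)))) \<partial>lborel)
        \<le> ennreal (A * ((4 * r) ^ CARD('n) * (4 * q) ^ CARD('m)) powr p) * ennreal (G v powr p * w v)" .
  qed
  also have "\<dots> = ennreal (A * ((4 * r) ^ CARD('n) * (4 * q) ^ CARD('m)) powr p) * (\<integral>\<^sup>+z. ennreal (G z powr p * w z) \<partial>lborel)"
    by (rule nn_integral_cmult) measurable
  finally show ?thesis unfolding I_def .
qed

end

subsection \<open>Mixed differences\<close>

text \<open>The chain rule along the line through \<open>z\<close>. As \<open>deriv\<close> is
  defined by choice, its value is known only once a derivative has been exhibited.\<close>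

lemma dirderiv_eq_derivative:
  assumes "(g has_derivative D) (at z)"
  shows "dirderiv v g z = D v"
proof -
  have "((\<lambda>t. g (z + t *\<^sub>R v)) has_derivative (\<lambda>t. D (t *\<^sub>R v))) (at 0)"
    by (rule has_derivative_compose[of "\<lambda>t. z + t *\<^sub>R v" "\<lambda>t. t *\<^sub>R v"])
       (use assms in \<open>auto intro!: derivative_eq_intros\<close>)
  moreover have "(\<lambda>t. D (t *\<^sub>R v)) = (*) (D v)"
    using has_derivative_linear[OF assms] by (auto simp: linear_scale)
  ultimately show ?thesis
    unfolding dirderiv_def by (intro DERIV_imp_deriv) (simp add: has_field_derivative_def)
qed

lemma has_derivative_line_fst:
  fixes g :: "('n::finite,'m::finite) pt \<Rightarrow> real"
  assumes "g differentiable (at (x + s *\<^sub>R d, y))"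
  shows "((\<lambda>s. g (x + s *\<^sub>R d, y)) has_real_derivative
           (\<Sum>i\<in>UNIV. d $ i * dirderiv (axis i 1, 0) g (x + s *\<^sub>R d, y))) (at s)"
proof -
  obtain D where D: "(g has_derivative D) (at (x + s *\<^sub>R d, y))"
    using assms by (auto simp: differentiable_def)
  have lin: "linear D" using has_derivative_linear[OF D] .
  have "((\<lambda>s. g (x + s *\<^sub>R d, y)) has_derivative (\<lambda>t. D (t *\<^sub>R d, 0))) (at s)"
    by (rule has_derivative_compose[of "\<lambda>s. (x + s *\<^sub>R d, y)" "\<lambda>t. (t *\<^sub>R d, 0)"])
       (use D in \<open>auto intro!: derivative_eq_intros\<close>)
  moreover have "D (t *\<^sub>R d, 0) = (\<Sum>i\<in>UNIV. d $ i * D (axis i 1, 0)) * t" for t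
  proof -
    have "(t *\<^sub>R d, 0) = t *\<^sub>R (\<Sum>i\<in>UNIV. (d $ i) *\<^sub>R (axis i 1, 0 :: real^'m))"
      using basis_expansion[of d] by (simp add: prod_eq_iff fst_sum snd_sum scalar_mult_eq_scaleR)
    then show ?thesis by (simp only: linear_scale[OF lin] linear_sum[OF lin]) (simp add: mult.commute)
  qed
  ultimately show ?thesis
    by (simp add: has_field_derivative_def dirderiv_eq_derivative[OF D] fun_eq_iff cong: sum.cong)
qed

lemma has_derivative_line_snd:
  fixes g :: "('n::finite,'m::finite) pt \<Rightarrow> real"
  assumes "g differentiable (at (x, y + s *\<^sub>R d))"
  shows "((\<lambda>s. g (x, y + s *\<^sub>R d)) has_real_derivative
           (\<Sum>i\<in>UNIV. d $ i * dirderiv (0, axis i 1) g (x, y + s *\<^sub>R d))) (at s)"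
proof -
  obtain D where D: "(g has_derivative D) (at (x, y + s *\<^sub>R d))"
    using assms by (auto simp: differentiable_def)
  have lin: "linear D" using has_derivative_linear[OF D] .
  have "((\<lambda>s. g (x, y + s *\<^sub>R d)) has_derivative (\<lambda>t. D (0, t *\<^sub>R d))) (at s)"
    by (rule has_derivative_compose[of "\<lambda>s. (x, y + s *\<^sub>R d)" "\<lambda>t. (0, t *\<^sub>R d)"])
       (use D in \<open>auto intro!: derivative_eq_intros\<close>)
  moreover have "D (0, t *\<^sub>R d) = (\<Sum>i\<in>UNIV. d $ i * D (0, axis i 1)) * t" for t
  proof -
    have "(0, t *\<^sub>R d) = t *\<^sub>R (\<Sum>i\<in>UNIV. (d $ i) *\<^sub>R (0 :: real^'n, axis i 1))"
      using basis_expansion[of d] by (simp add: prod_eq_iff fst_sum snd_sum scalar_mult_eq_scaleR)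
    then show ?thesis by (simp only: linear_scale[OF lin] linear_sum[OF lin]) (simp add: mult.commute)
  qed
  ultimately show ?thesis
    by (simp add: has_field_derivative_def dirderiv_eq_derivative[OF D] fun_eq_iff cong: sum.cong)
qed

text \<open>The fundamental theorem of calculus. The interval is open at 0 because its variable
  later becomes a dilation factor, which must be positive; the point 0 is a null set.\<close>

lemma abs_diff_le_nn_integral_deriv:
  fixes F F' :: "real \<Rightarrow> real"
  assumes "\<And>x. 0 \<le> x \<Longrightarrow> x \<le> 1 \<Longrightarrow> (F has_real_derivative F' x) (at x)" "continuous_on {0..1} F'"
  shows "ennreal \<bar>F 1 - F 0\<bar> \<le> (\<integral>\<^sup>+x\<in>{0<..1}. ennreal \<bar>F' x\<bar> \<partial>lborel)"
proof -
  have "has_bochner_integral lborel (\<lambda>x. indicator {0..1} x *\<^sub>R F' x) (F 1 - F 0)"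
    by (rule has_bochner_integral_FTC_Icc)
       (use assms in \<open>auto simp flip: has_real_derivative_iff_has_vector_derivative intro: DERIV_subset\<close>)
  then have "ennreal (norm (F 1 - F 0)) \<le> (\<integral>\<^sup>+x. ennreal (norm (indicator {0..1} x *\<^sub>R F' x)) \<partial>lborel)"
    using integral_norm_bound_ennreal[of lborel "\<lambda>x. indicator {0..1} x *\<^sub>R F' x"]
    by (simp add: has_bochner_integral_iff)
  also have "\<dots> = (\<integral>\<^sup>+x\<in>{0<..1}. ennreal \<bar>F' x\<bar> \<partial>lborel)"
    using AE_lborel_singleton[of "0::real"]
    by (intro nn_integral_cong_AE) (auto elim!: eventually_mono split: split_indicator)
  finally show ?thesis by simp
qed

lemma abs_mixed_le: "\<bar>mixed i j f z\<bar> \<le> mixed_grad_norm f z"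
proof -
  have "(mixed i j f z)\<^sup>2 \<le> (\<Sum>j\<in>UNIV. (mixed i j f z)\<^sup>2)"
    by (rule member_le_sum) auto
  also have "\<dots> \<le> (\<Sum>i\<in>UNIV. \<Sum>j\<in>UNIV. (mixed i j f z)\<^sup>2)"
    by (rule member_le_sum[of i UNIV "\<lambda>i. \<Sum>j\<in>UNIV. (mixed i j f z)\<^sup>2"]) (auto intro: sum_nonneg)
  finally show ?thesis
    unfolding mixed_grad_norm_def by (metis real_sqrt_abs real_sqrt_le_iff)
qed

lemma mixed_grad_norm_nonneg: "0 \<le> mixed_grad_norm f z"
  using abs_mixed_le[of undefined undefined f z] by (rule order_trans[rotated]) simp

lemma C2_on_continuous_mixed:
  assumes "C2_on U f"
  shows "continuous_on U (mixed i j f)" "continuous_on U (mixed_grad_norm f)"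
proof -
  show *: "continuous_on U (mixed i j f)" for i j
    using assms by (auto simp: C2_on_def mixed_def Basis_prod_def axis_in_Basis_iff)
  show "continuous_on U (mixed_grad_norm f)"
    unfolding mixed_grad_norm_def[abs_def] by (intro continuous_intros *)
qed

text \<open>The fundamental theorem is used once along the segment in \<open>X\<close> and once
  along the segment in \<open>Y\<close>; convexity keeps both inside. The indicator equals 1 on the
  path and prepares the extension of the gradient by zero.\<close>

lemma mixed_difference_le:
  fixes f :: "('n::finite,'m::finite) pt \<Rightarrow> real"
  assumes f: "C2_on U f" and R: "X \<times> Y \<subseteq> U" "convex X" "convex Y"
    and pts: "x \<in> X" "x' \<in> X" "y \<in> Y" "y' \<in> Y"
    and h: "\<And>i. \<bar>x' $ i - x $ i\<bar> \<le> h" and k: "\<And>j. \<bar>y' $ j - y $ j\<bar> \<le> k"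
  shows "ennreal \<bar>f (x, y) - f (x', y) - f (x, y') + f (x', y')\<bar>
    \<le> (\<integral>\<^sup>+s\<in>{0<..1}. (\<integral>\<^sup>+t\<in>{0<..1}. ennreal (real CARD('n) * real CARD('m) * h * k *
          (mixed_grad_norm f (x + s *\<^sub>R (x' - x), y + t *\<^sub>R (y' - y)) *
           indicator (X \<times> Y) (x + s *\<^sub>R (x' - x), y + t *\<^sub>R (y' - y)))) \<partial>lborel) \<partial>lborel)"
proof -
  let ?c = "real CARD('n) * real CARD('m) * h * k"
  define dx dy where "dx = x' - x" and "dy = y' - y"
  define g where "g i = dirderiv (axis i 1, 0) f" for i :: 'n
  have U: "open U" using f by (simp add: C2_on_def)
  have inX: "x + s *\<^sub>R dx \<in> X" if "s \<in> {0..1}" for s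
    using convexD_alt[OF R(2) pts(1,2), of s] that by (simp add: dx_def algebra_simps)
  have inY: "y + s *\<^sub>R dy \<in> Y" if "s \<in> {0..1}" for s
    using convexD_alt[OF R(3) pts(3,4), of s] that by (simp add: dy_def algebra_simps)
  have f_diff: "f differentiable (at z)" and g_diff: "g i differentiable (at z)" if "z \<in> U" for z i
    using f that U unfolding C2_on_def g_def
    by (auto simp: Basis_prod_def axis_in_Basis_iff differentiable_on_eq_differentiable_at)
  have g_cont: "continuous_on U (g i)" for i
    using g_diff by (intro continuous_at_imp_continuous_on ballI differentiable_imp_continuous_within)
  have mix: "dirderiv (0, axis j 1) (g i) = mixed i j f" for i j
    by (simp add: mixed_def g_def)
  have hk: "0 \<le> h" "0 \<le> k" using h k abs_ge_zero order_trans by blast+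
  \<comment> \<open>The increment of \<open>u\<close> over the unit interval is exactly the mixed
    difference.\<close>
  define u where "u s = f (x + s *\<^sub>R dx, y') - f (x + s *\<^sub>R dx, y)" for s
  define u' where "u' s = (\<Sum>i\<in>UNIV. dx $ i * (g i (x + s *\<^sub>R dx, y') - g i (x + s *\<^sub>R dx, y)))" for s
  have "ennreal \<bar>u 1 - u 0\<bar> \<le> (\<integral>\<^sup>+s\<in>{0<..1}. ennreal \<bar>u' s\<bar> \<partial>lborel)"
  proof (rule abs_diff_le_nn_integral_deriv)
    fix s :: real assume "0 \<le> s" "s \<le> 1"
    then have "f differentiable (at (x + s *\<^sub>R dx, y'))" "f differentiable (at (x + s *\<^sub>R dx, y))"
      using inX[of s] pts R(1) by (auto intro!: f_diff)
    from this[THEN has_derivative_line_fst] show "(u has_real_derivative u' s) (at s)"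
      unfolding u_def u'_def g_def right_diff_distrib sum_subtractf by (rule DERIV_diff)
  next
    show "continuous_on {0..1} u'"
      unfolding u'_def using inX pts R(1)
      by (intro continuous_intros continuous_on_compose2[OF g_cont]) auto
  qed
  also have "\<dots> \<le> (\<integral>\<^sup>+s\<in>{0<..1}. (\<integral>\<^sup>+t\<in>{0<..1}. ennreal (?c *
          mixed_grad_norm f (x + s *\<^sub>R dx, y + t *\<^sub>R dy)) \<partial>lborel) \<partial>lborel)"
  proof (rule nn_integral_mono)
    fix s :: real
    show "ennreal \<bar>u' s\<bar> * indicator {0<..1} s \<le> (\<integral>\<^sup>+t\<in>{0<..1}. ennreal (?c *
          mixed_grad_norm f (x + s *\<^sub>R dx, y + t *\<^sub>R dy)) \<partial>lborel) * indicator {0<..1} s"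
    proof (cases "s \<in> {0<..1}")
      case True
      then have s: "s \<in> {0..1}" by simp
      \<comment> \<open>\<open>v\<close> joins the two values of the \<open>x\<close>-derivative
        whose difference is \<open>u' s\<close>, so a second integration brings in the mixed
        derivatives.\<close>
      define v where "v t = (\<Sum>i\<in>UNIV. dx $ i * g i (x + s *\<^sub>R dx, y + t *\<^sub>R dy))" for t
      define v' where "v' t = (\<Sum>i\<in>UNIV. dx $ i * (\<Sum>j\<in>UNIV. dy $ j * mixed i j f (x + s *\<^sub>R dx, y + t *\<^sub>R dy)))" for t
      have "u' s = v 1 - v 0"
        by (simp add: u'_def v_def dy_def right_diff_distrib sum_subtractf)
      have "ennreal \<bar>v 1 - v 0\<bar> \<le> (\<integral>\<^sup>+t\<in>{0<..1}. ennreal \<bar>v' t\<bar> \<partial>lborel)"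
      proof (rule abs_diff_le_nn_integral_deriv)
        fix t :: real assume "0 \<le> t" "t \<le> 1"
        then have "g i differentiable (at (x + s *\<^sub>R dx, y + t *\<^sub>R dy))" for i
          using inX[OF s] inY[of t] R(1) by (auto intro!: g_diff)
        from has_derivative_line_snd[OF this] show "(v has_real_derivative v' t) (at t)"
          unfolding v_def v'_def mix by (intro DERIV_sum DERIV_cmult) auto
      next
        show "continuous_on {0..1} v'"
          unfolding v'_def using inX[OF s] inY R(1)
          by (intro continuous_intros continuous_on_compose2[OF C2_on_continuous_mixed(1)[OF f]]) auto
      qed
      also have "\<dots> \<le> (\<integral>\<^sup>+t\<in>{0<..1}. ennreal (?c *
          mixed_grad_norm f (x + s *\<^sub>R dx, y + t *\<^sub>R dy)) \<partial>lborel)"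
      proof (intro nn_integral_mono mult_right_mono ennreal_leI)
        fix t
        let ?G = "mixed_grad_norm f (x + s *\<^sub>R dx, y + t *\<^sub>R dy)"
        \<comment> \<open>Each entry of the double sum is at most \<open>h * (k * ?G)\<close>; the
          number of entries gives the dimensional constant.\<close>
        have "\<bar>v' t\<bar> \<le> (\<Sum>i\<in>(UNIV::'n set). \<Sum>j\<in>(UNIV::'m set). h * (k * ?G))"
          unfolding v'_def sum_distrib_left
        proof (rule order_trans[OF sum_abs sum_mono], rule order_trans[OF sum_abs sum_mono])
          fix i j
          show "\<bar>dx $ i * (dy $ j * mixed i j f (x + s *\<^sub>R dx, y + t *\<^sub>R dy))\<bar> \<le> h * (k * ?G)"
            unfolding abs_mult using h[of i] k[of j] abs_mixed_le[of i j f] hk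
            by (intro mult_mono) (auto simp: dx_def dy_def)
        qed
        also have "\<dots> = ?c * ?G" by (simp add: mult_ac)
        finally show "\<bar>v' t\<bar> \<le> ?c * ?G" .
      qed auto
      finally show ?thesis using True \<open>u' s = v 1 - v 0\<close> by simp
    qed simp
  qed
  also have "\<dots> = (\<integral>\<^sup>+s\<in>{0<..1}. (\<integral>\<^sup>+t\<in>{0<..1}. ennreal (?c *
          (mixed_grad_norm f (x + s *\<^sub>R dx, y + t *\<^sub>R dy) *
           indicator (X \<times> Y) (x + s *\<^sub>R dx, y + t *\<^sub>R dy))) \<partial>lborel) \<partial>lborel)"
    using inX inY by (intro nn_integral_cong) (auto split: split_indicator intro!: nn_integral_cong)
  finally show ?thesis
    by (simp add: u_def dx_def dy_def algebra_simps)
qed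

subsection \<open>The pointwise bound\<close>

lemma set_integral_lborel_Times:
  fixes F :: "'a::euclidean_space \<times> 'b::euclidean_space \<Rightarrow> real"
  assumes "compact X" "compact Y" and F: "continuous_on (X \<times> Y) F"
  shows "set_integrable lborel (X \<times> Y) F"
    "(LINT u:X \<times> Y|lborel. F u) = (LINT s:X|lborel. LINT t:Y|lborel. F (s, t))"
proof -
  show int: "set_integrable lborel (X \<times> Y) F"
    unfolding set_integrable_def by (rule borel_integrable_compact) (use assms compact_Times in auto)
  then have "integrable (lborel \<Otimes>\<^sub>M lborel) (\<lambda>u. indicator (X \<times> Y) u *\<^sub>R F u)"
    by (simp add: lborel_prod set_integrable_def)
  from lborel_pair.integral_fst'[OF this]
  show "(LINT u:X \<times> Y|lborel. F u) = (LINT s:X|lborel. LINT t:Y|lborel. F (s, t))"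
    by (simp add: lborel_prod set_lebesgue_integral_def indicator_times mult.assoc)
qed

text \<open>Cut off to \<open>X\<close>, the function is Borel, and completing the measure does not
  change its integral. This links \<open>piR\<close>, stated over \<open>lebesgue\<close>, to Fubini
  over \<open>lborel\<close>.\<close>

lemma set_integral_lebesgue_eq_lborel:
  fixes F :: "'a::euclidean_space \<Rightarrow> real"
  assumes "compact X" "continuous_on X F"
  shows "(LINT s:X|lebesgue. F s) = (LINT s:X|lborel. F s)"
  unfolding set_lebesgue_integral_def
  by (rule integral_completion)
     (use borel_measurable_continuous_on_indicator[OF _ assms(2)] assms(1) in \<open>auto intro: borel_compact\<close>)

lemma compact_cube: "compact (cube a h)" and convex_cube: "convex (cube a h)"
  by (simp_all add: cube_def)

lemma measure_cube:
  fixes a :: "real^'n::finite"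
  assumes "0 < h"
  shows "measure lborel (cube a h) = h ^ CARD('n)" "measure lebesgue (cube a h) = h ^ CARD('n)"
  using assms by (simp_all add: cube_def content_cbox_plus measure_completion)

text \<open>Integrating the mixed difference over \<open>u\<close> turns each one-variable term into
  a slice integral times the volume of the other cube, which is the volume of the rectangle times
  \<open>f - piR\<close>. Keeping that volume on the left avoids division in
  \<open>ennreal\<close>.\<close>

lemma abs_diff_piR_le:
  fixes f :: "('n::finite,'m::finite) pt \<Rightarrow> real"
  assumes hk: "0 < h" "0 < k" and f: "continuous_on (rect a h b k) f" and z: "(x, y) \<in> rect a h b k"
  shows "ennreal (h ^ CARD('n) * k ^ CARD('m) * \<bar>f (x, y) - piR (cube a h) (cube b k) f (x, y)\<bar>)
    \<le> (\<integral>\<^sup>+u\<in>rect a h b k. ennreal \<bar>f (x, y) - f (fst u, y) - f (x, snd u) + f u\<bar> \<partial>lborel)"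
proof -
  let ?X = "cube a h" and ?Y = "cube b k"
  let ?D = "\<lambda>u. f (x, y) - f (fst u, y) - f (x, snd u) + f u"
  have xy: "x \<in> ?X" "y \<in> ?Y" using z by (auto simp: rect_def)
  note f' = f[unfolded rect_def]
  note Times = set_integral_lborel_Times[OF compact_cube compact_cube, of a h b k]
  have c1: "continuous_on ?X (\<lambda>s. f (s, y))" and c2: "continuous_on ?Y (\<lambda>t. f (x, t))"
    using xy by (auto intro!: continuous_on_compose2[OF f'] continuous_intros)
  have C1: "continuous_on (?X \<times> ?Y) (\<lambda>u. f (fst u, y))" and C2: "continuous_on (?X \<times> ?Y) (\<lambda>u. f (x, snd u))"
    using xy by (auto intro!: continuous_on_compose2[OF f'] continuous_intros)
  have i0: "(LINT u:?X \<times> ?Y|lborel. f (x, y)) = h ^ CARD('n) * k ^ CARD('m) * f (x, y)"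
    by (subst Times) (simp_all add: measure_cube hk set_lebesgue_integral_def)
  have i1: "(LINT u:?X \<times> ?Y|lborel. f (fst u, y)) = k ^ CARD('m) * (LINT s:?X|lborel. f (s, y))"
    by (subst Times(2)[OF C1]) (simp add: measure_cube hk set_lebesgue_integral_def mult_ac)
  have i2: "(LINT u:?X \<times> ?Y|lborel. f (x, snd u)) = h ^ CARD('n) * (LINT t:?Y|lborel. f (x, t))"
    by (subst Times(2)[OF C2]) (simp add: measure_cube hk set_lebesgue_integral_def mult_ac)
  have int: "set_integrable lborel (?X \<times> ?Y) ?D"
    by (intro set_integral_diff set_integral_add Times C1 C2 f' continuous_on_const)
  have "(LINT u:?X \<times> ?Y|lborel. ?D u) = (LINT u:?X \<times> ?Y|lborel. f (x, y)) - (LINT u:?X \<times> ?Y|lborel. f (fst u, y))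
      - (LINT u:?X \<times> ?Y|lborel. f (x, snd u)) + (LINT u:?X \<times> ?Y|lborel. f u)"
    by (simp add: set_integral_diff set_integral_add Times C1 C2 f' continuous_on_const)
  also have "\<dots> = h ^ CARD('n) * k ^ CARD('m) * (f (x, y) - piR ?X ?Y f (x, y))"
    using hk emeasure_rect(2)[OF hk, of a b]
    by (simp add: piR_def i0 i1 i2 set_integral_lebesgue_eq_lborel compact_cube c1 c2 f' compact_Times
        measure_cube rect_def field_simps)
  finally have "ennreal (h ^ CARD('n) * k ^ CARD('m) * \<bar>f (x, y) - piR ?X ?Y f (x, y)\<bar>)
      = ennreal (norm (LINT u:?X \<times> ?Y|lborel. ?D u))"
    using hk by (simp add: abs_mult)
  also have "\<dots> \<le> (\<integral>\<^sup>+u. ennreal (norm (indicator (?X \<times> ?Y) u *\<^sub>R ?D u)) \<partial>lborel)"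
    unfolding set_lebesgue_integral_def by (rule integral_norm_bound_ennreal) (use int in \<open>simp add: set_integrable_def\<close>)
  also have "\<dots> = (\<integral>\<^sup>+u\<in>rect a h b k. ennreal \<bar>?D u\<bar> \<partial>lborel)"
    unfolding rect_def by (intro nn_integral_cong) (auto split: split_indicator)
  finally show ?thesis .
qed

section \<open>Two-parameter dilations about a point\<close>

lemma nn_integral_lborel_dilation:
  fixes H :: "'a::euclidean_space \<Rightarrow> ennreal"
  assumes s: "0 < s" and [measurable]: "H \<in> borel_measurable borel"
  shows "ennreal (s ^ DIM('a)) * (\<integral>\<^sup>+u. H (x + s *\<^sub>R (u - x)) \<partial>lborel) = integral\<^sup>N lborel H"
proof -
  have "integral\<^sup>N lborel H =
      integral\<^sup>N (density (distr lborel borel (\<lambda>u. (x - s *\<^sub>R x) + s *\<^sub>R u)) (\<lambda>_. \<bar>s\<bar> ^ DIM('a))) H"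
    using s by (subst lborel_affine[of s "x - s *\<^sub>R x"]) auto
  also have "\<dots> = (\<integral>\<^sup>+u. ennreal (\<bar>s\<bar> ^ DIM('a)) * H ((x - s *\<^sub>R x) + s *\<^sub>R u) \<partial>lborel)"
    by (simp add: nn_integral_density nn_integral_distr)
  also have "\<dots> = (\<integral>\<^sup>+u. ennreal (s ^ DIM('a)) * H (x + s *\<^sub>R (u - x)) \<partial>lborel)"
    using s by (simp add: algebra_simps)
  also have "\<dots> = ennreal (s ^ DIM('a)) * (\<integral>\<^sup>+u. H (x + s *\<^sub>R (u - x)) \<partial>lborel)"
    by (rule nn_integral_cmult) measurable
  finally show ?thesis by simp
qed

text \<open>Both factors form one variable \<open>\<sigma>\<close>, so the integrals over
  \<open>s\<close> and \<open>t\<close> become one integral over the unit square, and continuity in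
  all arguments yields joint measurability.\<close>

definition dil :: "real \<times> real \<Rightarrow> ('n::finite,'m::finite) pt \<Rightarrow> ('n,'m) pt \<Rightarrow> ('n,'m) pt" where
  "dil \<sigma> z u = (fst z + fst \<sigma> *\<^sub>R (fst u - fst z), snd z + snd \<sigma> *\<^sub>R (snd u - snd z))"

lemma measurable_dil [measurable]:
  assumes [measurable]: "\<sigma> \<in> measurable M borel" "z \<in> measurable M borel" "u \<in> measurable M borel"
  shows "(\<lambda>x. dil (\<sigma> x) (z x) (u x)) \<in> measurable M borel"
proof -
  have "continuous_on UNIV (\<lambda>y. dil (fst y) (fst (snd y)) (snd (snd y)))"
    unfolding dil_def by (intro continuous_intros)
  then have [measurable]: "(\<lambda>y. dil (fst y) (fst (snd y)) (snd (snd y))) \<in> borel_measurable borel"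
    by (rule borel_measurable_continuous_onI)
  have [measurable]: "(\<lambda>x. (\<sigma> x, z x, u x)) \<in> measurable M borel"
    by (intro borel_measurable_Pair assms)
  have "(\<lambda>x. (\<lambda>y. dil (fst y) (fst (snd y)) (snd (snd y))) (\<sigma> x, z x, u x)) \<in> measurable M borel"
    by (rule measurable_compose[where N=borel]) measurable
  then show ?thesis by simp
qed

text \<open>The blocks are dilated one after the other by Tonelli, with Jacobians
  \<open>t ^ CARD('m)\<close> and \<open>s ^ CARD('n)\<close>.\<close>

lemma nn_integral_dil:
  fixes H :: "('n::finite,'m::finite) pt \<Rightarrow> ennreal"
  assumes st: "0 < s" "0 < t" and [measurable]: "H \<in> borel_measurable borel"
  shows "ennreal (s ^ CARD('n) * t ^ CARD('m)) * (\<integral>\<^sup>+u. H (dil (s, t) z u) \<partial>lborel) = integral\<^sup>N lborel H"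
proof -
  have [measurable]: "H \<in> borel_measurable (lborel \<Otimes>\<^sub>M lborel)"
    by (simp add: lborel_prod)
  have [measurable]: "H \<in> borel_measurable (borel \<Otimes>\<^sub>M borel)"
    by (simp add: borel_prod)
  let ?x = "fst z" and ?y = "snd z"
  have "integral\<^sup>N lborel H = (\<integral>\<^sup>+x'. \<integral>\<^sup>+y'. H (x', y') \<partial>lborel \<partial>lborel)"
    by (subst lborel.nn_integral_fst) (simp_all add: lborel_prod)
  also have "\<dots> = (\<integral>\<^sup>+x'. ennreal (t ^ CARD('m)) * (\<integral>\<^sup>+y'. H (x', ?y + t *\<^sub>R (y' - ?y)) \<partial>lborel) \<partial>lborel)"
    by (intro nn_integral_cong nn_integral_lborel_dilation[of t "\<lambda>y'. H (_, y')" ?y, simplified, symmetric] st) measurable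
  also have "\<dots> = ennreal (t ^ CARD('m)) * (\<integral>\<^sup>+x'. (\<integral>\<^sup>+y'. H (x', ?y + t *\<^sub>R (y' - ?y)) \<partial>lborel) \<partial>lborel)"
    by (rule nn_integral_cmult) measurable
  also have "\<dots> = ennreal (t ^ CARD('m)) * (ennreal (s ^ CARD('n)) *
      (\<integral>\<^sup>+x'. (\<integral>\<^sup>+y'. H (?x + s *\<^sub>R (x' - ?x), ?y + t *\<^sub>R (y' - ?y)) \<partial>lborel) \<partial>lborel))"
    by (subst nn_integral_lborel_dilation[of s "\<lambda>x'. \<integral>\<^sup>+y'. H (x', ?y + t *\<^sub>R (y' - ?y)) \<partial>lborel" ?x, simplified, symmetric])
       (use st in auto)
  also have "(\<integral>\<^sup>+x'. (\<integral>\<^sup>+y'. H (?x + s *\<^sub>R (x' - ?x), ?y + t *\<^sub>R (y' - ?y)) \<partial>lborel) \<partial>lborel)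
      = (\<integral>\<^sup>+u. H (dil (s, t) z u) \<partial>lborel)"
  proof -
    have "(\<lambda>u. H (dil (s, t) z u)) \<in> borel_measurable (lborel \<Otimes>\<^sub>M lborel)"
      unfolding lborel_prod by measurable
    from lborel.nn_integral_fst[OF this] show ?thesis
      by (simp add: lborel_prod dil_def)
  qed
  finally show ?thesis
    using st by (simp add: ennreal_mult mult_ac)
qed

lemma dil_mem_nbhd:
  assumes "z \<in> rect a h b k" "u \<in> rect a h b k" "0 \<le> s" "0 \<le> t"
  shows "dil (s, t) z u \<in> nbhd (s * h) (t * k) z"
proof -
  have "\<bar>fst u $ i - fst z $ i\<bar> \<le> h" "\<bar>snd u $ j - snd z $ j\<bar> \<le> k" for i j
    using assms(1,2) by (auto simp: rect_def intro: cube_abs_diff_le)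
  then show ?thesis
    using assms(3,4) by (simp add: mem_nbhd dil_def abs_mult mult_left_mono)
qed

lemma C2_on_mixed_bounded:
  assumes "rect a h b k \<subseteq> U" "C2_on U f"
  obtains B where "0 \<le> B" "\<And>z. z \<in> rect a h b k \<Longrightarrow> mixed_grad_norm f z \<le> B"
proof -
  have "compact (rect a h b k)"
    unfolding rect_def by (intro compact_Times compact_cube)
  with continuous_on_subset[OF C2_on_continuous_mixed(2)[OF assms(2)] assms(1)]
  have "bounded (mixed_grad_norm f ` rect a h b k)"
    by (intro compact_imp_bounded compact_continuous_image)
  then obtain B where B: "0 < B" "\<forall>y \<in> mixed_grad_norm f ` rect a h b k. norm y \<le> B"
    unfolding bounded_pos by auto
  show ?thesis
  proof (rule that[of B])
    show "mixed_grad_norm f z \<le> B" if "z \<in> rect a h b k" for z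
      using B(2) that mixed_grad_norm_nonneg[of f z] by auto
  qed (use B in simp)
qed

section \<open>Weighted bounds for dilated averages and the Poincare inequality\<close>

context Ap_weight
begin

text \<open>Dilation turns the average over the rectangle into an integral over the box around
  \<open>z\<close> of half sides \<open>s * h\<close> and \<open>t * k\<close>, to which
  \<open>averaging_bound\<close> applies. The resulting constant is free of \<open>s\<close> and
  \<open>t\<close>, so it survives integration over them.\<close>

lemma weighted_dil_bound:
  assumes hk: "0 < h" "0 < k" and st: "0 < s" "0 < t"
    and [measurable]: "G \<in> borel_measurable borel"
    and G: "\<And>z. 0 \<le> G z" "\<And>z. G z \<le> B" and c: "0 \<le> c"
  shows "(\<integral>\<^sup>+z\<in>rect a h b k. ennreal ((c * (enn2real (\<integral>\<^sup>+u\<in>rect a h b k. ennreal (G (dil (s, t) z u)) \<partial>lborel)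
            / (h ^ CARD('n) * k ^ CARD('m)))) powr p * w z) \<partial>lborel)
    \<le> ennreal (A * (c * 4 ^ CARD('n) * 4 ^ CARD('m)) powr p) * (\<integral>\<^sup>+z. ennreal (G z powr p * w z) \<partial>lborel)"
proof -
  let ?R = "rect a h b k"
  let ?V = "h ^ CARD('n) * k ^ CARD('m)" and ?v = "s ^ CARD('n) * t ^ CARD('m)"
  define J where "J z = enn2real (\<integral>\<^sup>+u\<in>?R. ennreal (G (dil (s, t) z u)) \<partial>lborel)" for z
  define I where "I z = enn2real (\<integral>\<^sup>+v\<in>nbhd (s * h) (t * k) z. ennreal (G v) \<partial>lborel)" for z
  have pos: "0 < ?V" "0 < ?v" using hk st by auto
  have J_le: "J z \<le> I z / ?v" if z: "z \<in> ?R" for z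
  proof -
    let ?N = "nbhd (s * h) (t * k) z"
    have fin: "(\<integral>\<^sup>+v\<in>?N. ennreal (G v) \<partial>lborel) < top"
    proof -
      have "(\<integral>\<^sup>+v\<in>?N. ennreal (G v) \<partial>lborel) \<le> (\<integral>\<^sup>+v\<in>?N. ennreal B \<partial>lborel)"
        using G by (intro nn_integral_mono mult_right_mono ennreal_leI) auto
      also have "\<dots> < top"
        using hk st by (simp add: nbhd_def nn_integral_cmult emeasure_rect ennreal_mult_less_top)
      finally show ?thesis .
    qed
    have [measurable]: "?N \<in> sets borel" by (simp add: nbhd_def)
    \<comment> \<open>Dilation about \<open>z\<close> maps \<open>?R\<close> into \<open>?N\<close>,
      so the integral may be extended to the whole space, where the change of variables
      acts.\<close>
    have "(\<integral>\<^sup>+u\<in>?R. ennreal (G (dil (s, t) z u)) \<partial>lborel)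
        \<le> (\<integral>\<^sup>+u. ennreal (G (dil (s, t) z u)) * indicator ?N (dil (s, t) z u) \<partial>lborel)"
      using dil_mem_nbhd[OF z, of _ s t] st by (intro nn_integral_mono) (auto split: split_indicator)
    then have "ennreal ?v * (\<integral>\<^sup>+u\<in>?R. ennreal (G (dil (s, t) z u)) \<partial>lborel)
        \<le> ennreal ?v * (\<integral>\<^sup>+u. ennreal (G (dil (s, t) z u)) * indicator ?N (dil (s, t) z u) \<partial>lborel)"
      by (rule mult_left_mono) simp
    also have "\<dots> = (\<integral>\<^sup>+v\<in>?N. ennreal (G v) \<partial>lborel)"
      by (rule nn_integral_dil[OF st]) measurable
    finally have "enn2real (ennreal ?v * (\<integral>\<^sup>+u\<in>?R. ennreal (G (dil (s, t) z u)) \<partial>lborel)) \<le> I z"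
      unfolding I_def by (rule enn2real_mono) (rule fin)
    then have "?v * J z \<le> I z"
      using pos by (simp add: enn2real_mult J_def)
    then show ?thesis using pos by (simp add: field_simps)
  qed
  have "(\<integral>\<^sup>+z\<in>?R. ennreal ((c * (J z / ?V)) powr p * w z) \<partial>lborel)
      \<le> (\<integral>\<^sup>+z. ennreal ((c / (?v * ?V)) powr p) * ennreal (w z * I z powr p) \<partial>lborel)"
  proof (rule nn_integral_mono)
    fix z
    show "ennreal ((c * (J z / ?V)) powr p * w z) * indicator ?R z
        \<le> ennreal ((c / (?v * ?V)) powr p) * ennreal (w z * I z powr p)"
    proof (cases "z \<in> ?R")
      case True
      have "J z / ?V \<le> I z / ?v / ?V"
        using J_le[OF True] pos by (intro divide_right_mono) auto
      then have "c * (J z / ?V) \<le> c / (?v * ?V) * I z"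
        using mult_left_mono[of "J z / ?V" "I z / ?v / ?V" c] c by simp
      then have "(c * (J z / ?V)) powr p \<le> (c / (?v * ?V) * I z) powr p"
        using p c pos by (intro powr_mono2) (auto simp: J_def)
      also have "\<dots> = (c / (?v * ?V)) powr p * I z powr p"
        by (rule powr_mult)
      finally have "(c * (J z / ?V)) powr p * w z \<le> (c / (?v * ?V)) powr p * I z powr p * w z"
        by (rule mult_right_mono) (rule w_nonneg)
      then have "(c * (J z / ?V)) powr p * w z \<le> (c / (?v * ?V)) powr p * (w z * I z powr p)"
        by (simp add: mult_ac)
      then show ?thesis
        using True w_nonneg[of z] by (simp add: ennreal_mult[symmetric] ennreal_leI)
    qed simp
  qed
  also have "\<dots> = ennreal ((c / (?v * ?V)) powr p) * (\<integral>\<^sup>+z. ennreal (w z * I z powr p) \<partial>lborel)"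
    unfolding I_def by (rule nn_integral_cmult) measurable
  also have "\<dots> \<le> ennreal ((c / (?v * ?V)) powr p) *
      (ennreal (A * ((4 * (s * h)) ^ CARD('n) * (4 * (t * k)) ^ CARD('m)) powr p) * (\<integral>\<^sup>+z. ennreal (G z powr p * w z) \<partial>lborel))"
    unfolding I_def using hk st G by (intro mult_left_mono averaging_bound) auto
  also have "\<dots> = ennreal ((c / (?v * ?V)) powr p * (A * ((4 * (s * h)) ^ CARD('n) * (4 * (t * k)) ^ CARD('m)) powr p)) *
      (\<integral>\<^sup>+z. ennreal (G z powr p * w z) \<partial>lborel)"
    using A_ge_1 by (simp add: ennreal_mult mult.assoc)
  also have "(c / (?v * ?V)) powr p * (A * ((4 * (s * h)) ^ CARD('n) * (4 * (t * k)) ^ CARD('m)) powr p)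
      = A * (c / (?v * ?V) * ((4 * (s * h)) ^ CARD('n) * (4 * (t * k)) ^ CARD('m))) powr p"
    using c hk st by (subst powr_mult[of "c / (?v * ?V)"]) auto
  \<comment> \<open>The Jacobian and the volume cancel all powers of \<open>s\<close>,
    \<open>t\<close>, \<open>h\<close> and \<open>k\<close> from the box; only powers of 4
    remain.\<close>
  also have "c / (?v * ?V) * ((4 * (s * h)) ^ CARD('n) * (4 * (t * k)) ^ CARD('m)) = c * 4 ^ CARD('n) * 4 ^ CARD('m)"
    using hk st by (simp add: power_mult_distrib)
  finally show ?thesis unfolding J_def .
qed

text \<open>The unit square has measure 1, so Jensen moves the power inside the integral over
  \<open>\<sigma>\<close> at no cost. Tonelli then leaves one application of
  \<open>weighted_dil_bound\<close> for each fixed \<open>\<sigma>\<close>.\<close>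

lemma biparameter_Poincare:
  fixes h k :: real
  assumes hk: "0 < h" "0 < k" and R: "rect a h b k \<subseteq> U" and f: "C2_on U f"
  shows "(\<integral>\<^sup>+z\<in>rect a h b k. ennreal (\<bar>f z - piR (cube a h) (cube b k) f z\<bar> powr p * w z) \<partial>lborel)
    \<le> ennreal (A * (real CARD('n) * real CARD('m) * h * k * 4 ^ CARD('n) * 4 ^ CARD('m)) powr p) *
        (\<integral>\<^sup>+z\<in>rect a h b k. ennreal (mixed_grad_norm f z powr p * w z) \<partial>lborel)"
proof -
  let ?R = "rect a h b k" and ?Q = "{0<..1} \<times> {0<..1} :: (real \<times> real) set"
  let ?V = "h ^ CARD('n) * k ^ CARD('m)"
  let ?d = "\<lambda>z. \<bar>f z - piR (cube a h) (cube b k) f z\<bar>"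
  define c where "c = real CARD('n) * real CARD('m) * h * k"
  \<comment> \<open>Extended by zero, since the boxes around points of \<open>?R\<close> may leave
    \<open>?R\<close>.\<close>
  define G where "G z = mixed_grad_norm f z * indicator ?R z" for z
  define J where "J \<sigma> z = enn2real (\<integral>\<^sup>+u\<in>?R. ennreal (G (dil \<sigma> z u)) \<partial>lborel) / ?V" for \<sigma> z
  have V: "0 < ?V" and c: "0 \<le> c" using hk by (auto simp: c_def)
  have cont: "continuous_on ?R (mixed_grad_norm f)"
    using C2_on_continuous_mixed(2)[OF f] R by (rule continuous_on_subset)
  have G_nonneg: "0 \<le> G z" for z
    by (simp add: G_def mixed_grad_norm_nonneg)
  have [measurable]: "G \<in> borel_measurable borel"
    using borel_measurable_continuous_on_indicator[OF _ cont] by (simp add: G_def[abs_def] mult.commute)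
  obtain B where "0 \<le> B" "\<And>z. z \<in> ?R \<Longrightarrow> mixed_grad_norm f z \<le> B"
    using C2_on_mixed_bounded[OF R f] by blast
  then have G_le: "G z \<le> B" for z
    by (auto simp: G_def split: split_indicator)
  have J_fin: "(\<integral>\<^sup>+u\<in>?R. ennreal (G (dil \<sigma> z u)) \<partial>lborel) \<le> ennreal (B * ?V)" for \<sigma> z
  proof -
    have "(\<integral>\<^sup>+u\<in>?R. ennreal (G (dil \<sigma> z u)) \<partial>lborel) \<le> (\<integral>\<^sup>+u\<in>?R. ennreal B \<partial>lborel)"
      by (intro nn_integral_mono mult_right_mono ennreal_leI G_le) simp
    also have "\<dots> = ennreal (B * ?V)"
      using hk \<open>0 \<le> B\<close> by (simp add: nn_integral_cmult emeasure_rect ennreal_mult)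
    finally show ?thesis .
  qed
  have J_eq: "(\<integral>\<^sup>+u\<in>?R. ennreal (G (dil \<sigma> z u)) \<partial>lborel) = ennreal (?V * J \<sigma> z)" for \<sigma> z
  proof -
    have "(\<integral>\<^sup>+u\<in>?R. ennreal (G (dil \<sigma> z u)) \<partial>lborel) < top"
      by (rule le_less_trans[OF J_fin]) simp
    then show ?thesis using hk by (simp add: J_def)
  qed
  have J_nonneg: "0 \<le> J \<sigma> z" for \<sigma> z
    using V by (simp add: J_def)
  have J_le: "J \<sigma> z \<le> B" for \<sigma> z
  proof -
    have "J \<sigma> z * ?V \<le> B * ?V"
      using J_fin[of \<sigma> z] V \<open>0 \<le> B\<close> unfolding J_eq
      by (subst (asm) ennreal_le_iff) (auto simp: mult.commute)
    then show ?thesis using V by (rule mult_right_le_imp_le)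
  qed
  have [measurable]: "(\<lambda>x. J (\<sigma> x) (z x)) \<in> borel_measurable M"
    if [measurable]: "\<sigma> \<in> measurable M borel" "z \<in> measurable M borel" for M \<sigma> z
    unfolding J_def by measurable
  have [measurable]: "?Q \<in> sets borel"
    by (simp add: borel_Times)
  have Q1: "emeasure lborel ?Q = 1"
    by (simp add: lborel.emeasure_pair_measure_Times flip: lborel_prod)
  have d_le: "ennreal (?d z) \<le> (\<integral>\<^sup>+\<sigma>\<in>?Q. ennreal (c * J \<sigma> z) \<partial>lborel)" if z: "z \<in> ?R" for z
  proof -
    obtain x y where xy: "z = (x, y)" by (cases z)
    have "ennreal (?V * ?d z) \<le> (\<integral>\<^sup>+u\<in>?R. ennreal \<bar>f (x, y) - f (fst u, y) - f (x, snd u) + f u\<bar> \<partial>lborel)"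
    proof -
      have "continuous_on ?R f"
        using f R unfolding C2_on_def
        by (meson continuous_on_subset differentiable_imp_continuous_on)
      from abs_diff_piR_le[OF hk this z[unfolded xy]] show ?thesis unfolding xy .
    qed
    also have "\<dots> \<le> (\<integral>\<^sup>+u\<in>?R. (\<integral>\<^sup>+\<sigma>\<in>?Q. ennreal (c * G (dil \<sigma> z u)) \<partial>lborel) \<partial>lborel)"
    proof (rule nn_integral_mono)
      fix u
      show "ennreal \<bar>f (x, y) - f (fst u, y) - f (x, snd u) + f u\<bar> * indicator ?R u
        \<le> (\<integral>\<^sup>+\<sigma>\<in>?Q. ennreal (c * G (dil \<sigma> z u)) \<partial>lborel) * indicator ?R u"
      proof (cases "u \<in> ?R")
        case u: True
        have m: "(\<lambda>\<sigma>. ennreal (c * G (dil \<sigma> z u)) * indicator ?Q \<sigma>) \<in> borel_measurable (lborel \<Otimes>\<^sub>M lborel)"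
          unfolding lborel_prod by measurable
        have "ennreal \<bar>f (x, y) - f (fst u, y) - f (x, snd u) + f (fst u, snd u)\<bar>
          \<le> (\<integral>\<^sup>+s\<in>{0<..1}. (\<integral>\<^sup>+t\<in>{0<..1}. ennreal (real CARD('n) * real CARD('m) * h * k *
          (mixed_grad_norm f (x + s *\<^sub>R (fst u - x), y + t *\<^sub>R (snd u - y)) *
           indicator (cube a h \<times> cube b k) (x + s *\<^sub>R (fst u - x), y + t *\<^sub>R (snd u - y)))) \<partial>lborel) \<partial>lborel)"
        proof (rule mixed_difference_le[OF f _ convex_cube convex_cube])
          show "\<bar>fst u $ i - x $ i\<bar> \<le> h" for i
            using u z by (auto simp: xy rect_def intro: cube_abs_diff_le)
          show "\<bar>snd u $ i - y $ i\<bar> \<le> k" for i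
            using u z by (auto simp: xy rect_def intro: cube_abs_diff_le)
        qed (use R u z in \<open>auto simp: rect_def xy\<close>)
        also have "\<dots> = (\<integral>\<^sup>+s\<in>{0<..1}. (\<integral>\<^sup>+t\<in>{0<..1}. ennreal (c * G (dil (s, t) z u)) \<partial>lborel) \<partial>lborel)"
          by (simp add: c_def G_def dil_def xy rect_def)
        also have "\<dots> = (\<integral>\<^sup>+s. \<integral>\<^sup>+t. ennreal (c * G (dil (s, t) z u)) * indicator ?Q (s, t) \<partial>lborel \<partial>lborel)"
          by (intro nn_integral_cong) (auto split: split_indicator simp: indicator_times)
        also have "\<dots> = (\<integral>\<^sup>+\<sigma>\<in>?Q. ennreal (c * G (dil \<sigma> z u)) \<partial>lborel)"
          using lborel.nn_integral_fst[OF m] by (simp add: lborel_prod)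
        finally show ?thesis using u by simp
      qed simp
    qed
    also have "\<dots> = (\<integral>\<^sup>+u. \<integral>\<^sup>+\<sigma>. ennreal (c * G (dil \<sigma> z u)) * indicator ?Q \<sigma> * indicator ?R u \<partial>lborel \<partial>lborel)"
      by (intro nn_integral_cong nn_integral_multc[symmetric]) measurable
    also have "\<dots> = (\<integral>\<^sup>+\<sigma>. \<integral>\<^sup>+u. ennreal (c * G (dil \<sigma> z u)) * indicator ?Q \<sigma> * indicator ?R u \<partial>lborel \<partial>lborel)"
      by (rule lborel_pair.Fubini') measurable
    also have "\<dots> = (\<integral>\<^sup>+\<sigma>. ennreal c * indicator ?Q \<sigma> * (\<integral>\<^sup>+u\<in>?R. ennreal (G (dil \<sigma> z u)) \<partial>lborel) \<partial>lborel)"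
    proof (rule nn_integral_cong)
      fix \<sigma> :: "real \<times> real"
      show "(\<integral>\<^sup>+u. ennreal (c * G (dil \<sigma> z u)) * indicator ?Q \<sigma> * indicator ?R u \<partial>lborel)
        = ennreal c * indicator ?Q \<sigma> * (\<integral>\<^sup>+u\<in>?R. ennreal (G (dil \<sigma> z u)) \<partial>lborel)"
        using c G_nonneg by (subst nn_integral_cmult[symmetric]) (auto simp: ennreal_mult mult_ac)
    qed
    also have "\<dots> = (\<integral>\<^sup>+\<sigma>. ennreal ?V * (ennreal (c * J \<sigma> z) * indicator ?Q \<sigma>) \<partial>lborel)"
      unfolding J_eq using c V J_nonneg by (intro nn_integral_cong) (simp add: ennreal_mult mult_ac)
    also have "\<dots> = ennreal ?V * (\<integral>\<^sup>+\<sigma>\<in>?Q. ennreal (c * J \<sigma> z) \<partial>lborel)"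
      by (rule nn_integral_cmult) measurable
    finally have "ennreal ?V * ennreal (?d z) \<le> ennreal ?V * (\<integral>\<^sup>+\<sigma>\<in>?Q. ennreal (c * J \<sigma> z) \<partial>lborel)"
      using V by (simp add: ennreal_mult)
    then show ?thesis
      using V by (subst (asm) ennreal_mult_le_mult_iff) (auto simp: ennreal_eq_0_iff not_le)
  qed
  have Jensen: "ennreal (?d z powr p) \<le> (\<integral>\<^sup>+\<sigma>\<in>?Q. ennreal ((c * J \<sigma> z) powr p) \<partial>lborel)" if z: "z \<in> ?R" for z
  proof -
    define I where "I = enn2real (\<integral>\<^sup>+\<sigma>\<in>?Q. ennreal (c * J \<sigma> z) \<partial>lborel)"
    have "(\<integral>\<^sup>+\<sigma>\<in>?Q. ennreal (c * J \<sigma> z) \<partial>lborel) \<le> (\<integral>\<^sup>+\<sigma>\<in>?Q. ennreal (c * B) \<partial>lborel)"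
      using c J_le by (intro nn_integral_mono mult_right_mono ennreal_leI mult_left_mono) auto
    also have "\<dots> < top" by (simp add: nn_integral_cmult Q1)
    finally have I: "(\<integral>\<^sup>+\<sigma>\<in>?Q. ennreal (c * J \<sigma> z) \<partial>lborel) = ennreal I"
      by (simp add: I_def)
    have I0: "0 \<le> I" by (simp add: I_def)
    have "?d z \<le> I"
      using d_le[OF z] I0 unfolding I by (subst (asm) ennreal_le_iff) auto
    then have "ennreal (?d z powr p) \<le> ennreal (I powr p)"
      using p by (intro ennreal_leI powr_mono2) auto
    \<comment> \<open>The density of \<open>?Q\<close> turns Lebesgue measure into a probability
      measure.\<close>
    also have "\<dots> \<le> (\<integral>\<^sup>+\<sigma>. ennreal ((c * J \<sigma> z) powr p) \<partial>density lborel (indicator ?Q))"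
      by (rule nn_integral_Jensen_powr[OF p])
         (use I0 I c J_nonneg Q1 in \<open>auto simp: nn_integral_density emeasure_density mult.commute\<close>)
    also have "\<dots> = (\<integral>\<^sup>+\<sigma>\<in>?Q. ennreal ((c * J \<sigma> z) powr p) \<partial>lborel)"
      by (simp add: nn_integral_density mult.commute)
    finally show ?thesis .
  qed
  let ?K = "ennreal (A * (c * 4 ^ CARD('n) * 4 ^ CARD('m)) powr p) * (\<integral>\<^sup>+z. ennreal (G z powr p * w z) \<partial>lborel)"
  have "(\<integral>\<^sup>+z\<in>?R. ennreal (?d z powr p * w z) \<partial>lborel)
      \<le> (\<integral>\<^sup>+z. \<integral>\<^sup>+\<sigma>. ennreal ((c * J \<sigma> z) powr p) * indicator ?Q \<sigma> * (ennreal (w z) * indicator ?R z) \<partial>lborel \<partial>lborel)"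
  proof (rule nn_integral_mono)
    fix z
    show "ennreal (?d z powr p * w z) * indicator ?R z
      \<le> (\<integral>\<^sup>+\<sigma>. ennreal ((c * J \<sigma> z) powr p) * indicator ?Q \<sigma> * (ennreal (w z) * indicator ?R z) \<partial>lborel)"
    proof (cases "z \<in> ?R")
      case True
      have "ennreal (?d z powr p * w z) = ennreal (?d z powr p) * ennreal (w z)"
        using w_nonneg by (simp add: ennreal_mult)
      also have "\<dots> \<le> (\<integral>\<^sup>+\<sigma>\<in>?Q. ennreal ((c * J \<sigma> z) powr p) \<partial>lborel) * ennreal (w z)"
        by (intro mult_right_mono Jensen True) simp
      finally show ?thesis using True by (simp add: nn_integral_multc)
    qed simp
  qed
  also have "\<dots> = (\<integral>\<^sup>+\<sigma>. \<integral>\<^sup>+z. ennreal ((c * J \<sigma> z) powr p) * indicator ?Q \<sigma> * (ennreal (w z) * indicator ?R z) \<partial>lborel \<partial>lborel)"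
    by (rule lborel_pair.Fubini') measurable
  also have "\<dots> \<le> (\<integral>\<^sup>+\<sigma>\<in>?Q. ?K \<partial>lborel)"
  proof (rule nn_integral_mono)
    fix \<sigma> :: "real \<times> real"
    show "(\<integral>\<^sup>+z. ennreal ((c * J \<sigma> z) powr p) * indicator ?Q \<sigma> * (ennreal (w z) * indicator ?R z) \<partial>lborel) \<le> ?K * indicator ?Q \<sigma>"
    proof (cases "\<sigma> \<in> ?Q")
      case True
      then obtain s t where st: "\<sigma> = (s, t)" "0 < s" "0 < t" by auto
      have "(\<integral>\<^sup>+z. ennreal ((c * J \<sigma> z) powr p) * indicator ?Q \<sigma> * (ennreal (w z) * indicator ?R z) \<partial>lborel)
        = (\<integral>\<^sup>+z\<in>?R. ennreal ((c * J \<sigma> z) powr p * w z) \<partial>lborel)"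
        using True w_nonneg by (intro nn_integral_cong) (simp add: ennreal_mult mult_ac)
      also have "\<dots> \<le> ?K"
        unfolding J_def st(1) using hk st G_nonneg G_le c by (intro weighted_dil_bound[where B=B]) auto
      finally show ?thesis using True by simp
    qed simp
  qed
  also have "\<dots> = ?K"
    by (simp add: nn_integral_cmult Q1)
  \<comment> \<open>Outside \<open>?R\<close> the function \<open>G\<close> is 0, and so is its
    power.\<close>
  also have "(\<integral>\<^sup>+z. ennreal (G z powr p * w z) \<partial>lborel) = (\<integral>\<^sup>+z\<in>?R. ennreal (mixed_grad_norm f z powr p * w z) \<partial>lborel)"
    using p by (intro nn_integral_cong) (auto simp: G_def split: split_indicator)
  finally show ?thesis unfolding c_def by (simp add: mult.assoc)
qed

end

subsection \<open>Lebesgue measurable weights\<close>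

text \<open>\<open>weight\<close> gives measurability only on compact sets; \<open>w\<close> is the
  pointwise limit of its truncations to balls, which are eventually constant at each point.\<close>

lemma weight_borel_measurable_lebesgue:
  fixes w :: "('n::finite,'m::finite) pt \<Rightarrow> real"
  assumes "weight w"
  shows "w \<in> borel_measurable lebesgue"
proof (rule borel_measurable_LIMSEQ_real)
  fix n :: nat
  show "(\<lambda>z. indicator (cball 0 (real n)) z *\<^sub>R w z) \<in> borel_measurable lebesgue"
    using assms unfolding weight_def set_integrable_def by (intro borel_measurable_integrable) auto
next
  fix z :: "('n,'m) pt"
  obtain N :: nat where "norm z \<le> N" using real_arch_simple by blast
  then have "\<forall>n\<ge>N. indicator (cball 0 (real n)) z *\<^sub>R w z = w z"
    by (auto simp: indicator_def)
  then show "(\<lambda>n. indicator (cball 0 (real n)) z *\<^sub>R w z) \<longlonglongrightarrow> w z"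
    by (intro tendsto_eventually) (auto simp: eventually_sequentially)
qed

text \<open>Taking the maximum with 0 makes the representative nonnegative everywhere and not merely
  almost everywhere.\<close>

lemma weight_borel_representative:
  assumes "weight w"
  obtains w' where "w' \<in> borel_measurable borel" "\<And>z. 0 \<le> w' z" "AE z in lborel. w z = w' z"
proof -
  obtain g where g: "g \<in> borel_measurable lborel" "AE z in lborel. w z = g z"
    using completion_ex_borel_measurable_real[OF weight_borel_measurable_lebesgue[OF assms]] by blast
  have "AE z in lborel. w z = max 0 (g z)"
    using g(2)
  proof eventually_elim
    case (elim z)
    moreover have "0 \<le> w z" using assms unfolding weight_def by blast
    ultimately show ?case by simp
  qed
  with g(1) show ?thesis by (intro that[of "\<lambda>z. max 0 (g z)"]) auto
qed

lemma set_nn_integral_lebesgue_cong_AE: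
  assumes "AE z in lborel. w z = w' z" "\<And>z. w z = w' z \<Longrightarrow> F z = F' z"
  shows "(\<integral>\<^sup>+z\<in>R. F z \<partial>lebesgue) = (\<integral>\<^sup>+z\<in>R. F' z \<partial>lborel)"
  unfolding nn_integral_completion
  by (rule nn_integral_cong_AE) (use assms in \<open>auto elim: eventually_mono\<close>)

text \<open>Averages of the weight and of its dual ignore null sets, so the representative inherits
  the A_p bound with the constant of \<open>w\<close> itself.\<close>

lemma Ap_weight_representative:
  fixes w w' :: "('n::finite,'m::finite) pt \<Rightarrow> real"
  assumes p: "1 < p" and A: "in_Ap p w"
    and w': "w' \<in> borel_measurable borel" "\<And>z. 0 \<le> w' z" and eq: "AE z in lborel. w z = w' z"
  shows "Ap_weight p (Ap_const p w) w'"
proof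
  fix h k :: real and a :: "real^'n" and b :: "real^'m"
  assume hk: "0 < h" "0 < k"
  let ?R = "rect a h b k" and ?V = "h ^ CARD('n) * k ^ CARD('m)"
  define W S where "W = (\<integral>\<^sup>+z\<in>?R. ennreal (w' z) \<partial>lborel)" and "S = (\<integral>\<^sup>+z\<in>?R. dual_wt p w' z \<partial>lborel)"
  have R: "?R \<in> rects" using hk by (auto simp: rects_def)
  have V: "0 < ?V" using hk by simp
  have avg_w: "avg ?R (\<lambda>z. ennreal (w z)) = W / ennreal ?V"
    unfolding avg_def W_def emeasure_rect(2)[OF hk]
    by (subst set_nn_integral_lebesgue_cong_AE[OF eq]) auto
  have avg_d: "avg ?R (dual_wt p w) = S / ennreal ?V"
    unfolding avg_def S_def emeasure_rect(2)[OF hk]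
    by (subst set_nn_integral_lebesgue_cong_AE[OF eq, where F'="dual_wt p w'"]) (auto simp: dual_wt_def)
  have "W / ennreal ?V < top" "S / ennreal ?V < top"
    using A R unfolding in_Ap_def avg_w[symmetric] avg_d[symmetric] by auto
  then have fin: "W < top" "S < top"
    using V by (auto simp: ennreal_divide_eq_top_iff less_top[symmetric])
  then show "(\<integral>\<^sup>+z\<in>?R. ennreal (w' z) \<partial>lborel) < \<infinity>" "(\<integral>\<^sup>+z\<in>?R. dual_wt p w' z \<partial>lborel) < \<infinity>"
    by (simp_all add: W_def S_def)
  have div: "enn2real (x / ennreal ?V) = enn2real x / ?V" if "x < top" for x
    using that V by (cases x) (auto simp: divide_ennreal)
  have "Ap_quantity p w ?R \<le> Ap_const p w"
    unfolding Ap_const_def using A R by (intro cSUP_upper) (auto simp: in_Ap_def)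
  moreover have "Ap_quantity p w ?R = enn2real W * enn2real S powr (p - 1) / ?V powr p"
    unfolding Ap_quantity_def avg_w avg_d using fin V
    by (simp add: div powr_divide powr_diff)
  ultimately show "enn2real (\<integral>\<^sup>+z\<in>?R. ennreal (w' z) \<partial>lborel) * enn2real (\<integral>\<^sup>+z\<in>?R. dual_wt p w' z \<partial>lborel) powr (p - 1)
     \<le> Ap_const p w * ?V powr p"
    using hk by (simp add: W_def[symmetric] S_def[symmetric] divide_le_eq)
qed (use p w' in auto)

text \<open>A non-integrable function has Bochner integral 0, so the bound covers that case as well.
  It serves for the left side of the theorem, where an upper bound suffices.\<close>

lemma integral_le_enn2real_nn_integral:
  fixes g :: "'a \<Rightarrow> real"
  assumes "\<And>x. 0 \<le> g x"
  shows "integral\<^sup>L M g \<le> enn2real (\<integral>\<^sup>+x. ennreal (g x) \<partial>M)"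
proof (cases "integrable M g")
  case True
  then show ?thesis using assms by (subst integral_eq_nn_integral) auto
qed (simp add: not_integrable_integral_eq)

section \<open>The inequality for Lebesgue measurable weights\<close>

theorem theorem1p7:
  fixes p :: real
  assumes "1 < p"
  shows "\<exists>C>0. \<forall>w :: ('n::finite,'m::finite) pt \<Rightarrow> real. weight w \<and> in_Ap p w \<longrightarrow>
    (\<forall>(a::real^'n) h (b::real^'m) k f U. 0 < h \<longrightarrow> 0 < k \<longrightarrow>
       rect a h b k \<subseteq> U \<longrightarrow> C2_on U f \<longrightarrow>
       Lpw p (rect a h b k) w (\<lambda>z. f z - piR (cube a h) (cube b k) f z)
         \<le> C * Ap_const p w powr (min 4 (2 / (p - 1))) * h * k
             * Lpw p (rect a h b k) w (mixed_grad_norm f))"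
proof -
  \<comment> \<open>The constant of \<open>biparameter_Poincare\<close> inside the power
    \<open>p\<close>, without the side lengths.\<close>
  define C where "C = real CARD('n) * real CARD('m) * 4 ^ CARD('n) * 4 ^ CARD('m)"
  have C: "0 < C" by (simp add: C_def)
  show ?thesis
  proof (intro exI[of _ C] conjI C allI impI)
    fix w :: "('n,'m) pt \<Rightarrow> real" and a :: "real^'n" and h and b :: "real^'m" and k f U
    assume w: "weight w \<and> in_Ap p w" and hk: "0 < h" "0 < k"
      and R: "rect a h b k \<subseteq> U" and f: "C2_on U f"
    let ?R = "rect a h b k" and ?A = "Ap_const p w"
    let ?d = "\<lambda>z. f z - piR (cube a h) (cube b k) f z"
    obtain w' where w': "w' \<in> borel_measurable borel" "\<And>z. 0 \<le> w' z" and eq: "AE z in lborel. w z = w' z"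
      using weight_borel_representative w by blast
    interpret Ap_weight p ?A w'
      using Ap_weight_representative[OF assms _ w' eq] w by blast
    have w0: "0 \<le> w z" for z using w unfolding weight_def by blast
    have [measurable]: "w \<in> borel_measurable lebesgue"
      using weight_borel_measurable_lebesgue w by blast
    define N where "N = (\<integral>\<^sup>+z\<in>?R. ennreal (mixed_grad_norm f z powr p * w' z) \<partial>lborel)"
    obtain B where B: "0 \<le> B" "\<And>z. z \<in> ?R \<Longrightarrow> mixed_grad_norm f z \<le> B"
      using C2_on_mixed_bounded[OF R f] by blast
    \<comment> \<open>The gradient is bounded on the compact rectangle, so \<open>N\<close> is
      finite. This matters because \<open>enn2real\<close> sends \<open>top\<close> to 0.\<close>
    have "N \<le> (\<integral>\<^sup>+z. ennreal (B powr p) * (ennreal (w' z) * indicator ?R z) \<partial>lborel)"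
      unfolding N_def
    proof (rule nn_integral_mono)
      fix z
      have "mixed_grad_norm f z powr p * w' z \<le> B powr p * w' z" if "z \<in> ?R"
        using B(2)[OF that] w'(2)[of z] assms mixed_grad_norm_nonneg[of f z]
        by (intro mult_right_mono powr_mono2) auto
      then show "ennreal (mixed_grad_norm f z powr p * w' z) * indicator ?R z
          \<le> ennreal (B powr p) * (ennreal (w' z) * indicator ?R z)"
        using w'(2)[of z] by (auto simp: ennreal_mult[symmetric] intro!: ennreal_leI split: split_indicator)
    qed
    also have "\<dots> = ennreal (B powr p) * (\<integral>\<^sup>+z\<in>?R. ennreal (w' z) \<partial>lborel)"
      by (rule nn_integral_cmult) (use w' in measurable)
    also have "\<dots> < top"
      using w_fin[OF hk, of a b] by (simp add: ennreal_mult_less_top)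
    finally have N: "N < top" .
    \<comment> \<open>The right side needs equality: measurability of the integrand, and
      \<open>N\<close> being finite, rule out that the Bochner integral is 0 by default.\<close>
    have LR: "(LINT z:?R|lebesgue. \<bar>mixed_grad_norm f z\<bar> powr p * w z) = enn2real N"
    proof -
      have "continuous_on ?R (\<lambda>z. \<bar>mixed_grad_norm f z\<bar> powr p)"
        using continuous_on_subset[OF C2_on_continuous_mixed(2)[OF f] R] assms
        by (intro continuous_on_powr' continuous_intros) auto
      from borel_measurable_continuous_on_indicator[OF rect_borel this]
      have [measurable]: "(\<lambda>z. indicator ?R z *\<^sub>R \<bar>mixed_grad_norm f z\<bar> powr p) \<in> borel_measurable lebesgue"
        by (intro measurable_completion) simp
      have "(\<lambda>z. (indicator ?R z *\<^sub>R \<bar>mixed_grad_norm f z\<bar> powr p) * w z) \<in> borel_measurable lebesgue"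
        by measurable
      then have "(LINT z:?R|lebesgue. \<bar>mixed_grad_norm f z\<bar> powr p * w z)
          = enn2real (\<integral>\<^sup>+z. ennreal (indicator ?R z *\<^sub>R (\<bar>mixed_grad_norm f z\<bar> powr p * w z)) \<partial>lebesgue)"
        unfolding set_lebesgue_integral_def
        by (intro integral_eq_nn_integral) (auto simp: w0 mult_ac)
      also have "(\<integral>\<^sup>+z. ennreal (indicator ?R z *\<^sub>R (\<bar>mixed_grad_norm f z\<bar> powr p * w z)) \<partial>lebesgue)
          = (\<integral>\<^sup>+z\<in>?R. ennreal (mixed_grad_norm f z powr p * w z) \<partial>lebesgue)"
        by (intro nn_integral_cong) (auto simp: mixed_grad_norm_nonneg split: split_indicator)
      also have "\<dots> = N"
        unfolding N_def by (rule set_nn_integral_lebesgue_cong_AE[OF eq]) simp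
      finally show ?thesis .
    qed
    let ?K = "?A * (C * h * k) powr p"
    have K: "0 \<le> ?K" using A_ge_1 by simp
    have "(LINT z:?R|lebesgue. \<bar>?d z\<bar> powr p * w z)
        \<le> enn2real (\<integral>\<^sup>+z. ennreal (indicator ?R z *\<^sub>R (\<bar>?d z\<bar> powr p * w z)) \<partial>lebesgue)"
      unfolding set_lebesgue_integral_def by (rule integral_le_enn2real_nn_integral) (auto simp: w0)
    also have "(\<integral>\<^sup>+z. ennreal (indicator ?R z *\<^sub>R (\<bar>?d z\<bar> powr p * w z)) \<partial>lebesgue)
        = (\<integral>\<^sup>+z\<in>?R. ennreal (\<bar>?d z\<bar> powr p * w z) \<partial>lebesgue)"
      by (intro nn_integral_cong) (auto split: split_indicator)
    also have "\<dots> = (\<integral>\<^sup>+z\<in>?R. ennreal (\<bar>?d z\<bar> powr p * w' z) \<partial>lborel)"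
      by (rule set_nn_integral_lebesgue_cong_AE[OF eq]) simp
    also have "enn2real \<dots> \<le> enn2real (ennreal ?K * N)"
    proof (rule enn2real_mono)
      show "(\<integral>\<^sup>+z\<in>?R. ennreal (\<bar>?d z\<bar> powr p * w' z) \<partial>lborel) \<le> ennreal ?K * N"
        using biparameter_Poincare[OF hk R f] by (simp add: N_def C_def mult_ac)
    qed (use N in \<open>simp add: ennreal_mult_less_top\<close>)
    also have "\<dots> = ?K * enn2real N"
      using K by (simp add: enn2real_mult)
    finally have le: "(LINT z:?R|lebesgue. \<bar>?d z\<bar> powr p * w z) \<le> ?K * enn2real N" .
    have "Lpw p ?R w ?d \<le> (?K * enn2real N) powr (1 / p)"
      unfolding Lpw_def
      using le assms by (intro powr_mono2) (auto simp: set_lebesgue_integral_def w0 intro!: integral_nonneg)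
    also have "\<dots> = ?A powr (1 / p) * (C * h * k) * enn2real N powr (1 / p)"
      using C hk assms by (simp add: powr_mult powr_powr)
    also have "\<dots> \<le> ?A powr min 4 (2 / (p - 1)) * (C * h * k) * enn2real N powr (1 / p)"
    proof -
      \<comment> \<open>For \<open>p > 1\<close> one has \<open>1 / p < 1\<close> and
        \<open>p - 1 < 2 * p\<close>; as \<open>?A\<close> is at least 1, the larger exponent only
        weakens the bound.\<close>
      have "1 / p \<le> min 4 (2 / (p - 1))"
        using assms by (auto simp: field_simps)
      then show ?thesis
        using A_ge_1 C hk by (intro mult_right_mono powr_mono) auto
    qed
    also have "\<dots> = C * ?A powr min 4 (2 / (p - 1)) * h * k * Lpw p ?R w (mixed_grad_norm f)"
      by (simp add: Lpw_def LR)
    finally show "Lpw p ?R w ?d \<le> C * ?A powr min 4 (2 / (p - 1)) * h * k * Lpw p ?R w (mixed_grad_norm f)" .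
  qed
qed

end
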